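(* Let $\Delta t>0$ be arbitrary, $k\ge1$, and let $C>0$ be a constant. (A) Consider the first-order ME-SAV scheme: given $\phi^n$ and $r_i^n>0$ ($i=1,\dots,k$), find $\phi^{n+1},\mu^{n+1}$ and $r_i^{n+1}>0$ such that $$\frac{\phi^{n+1}-\phi^n}{\Delta t}=\mathcal G\mu^{n+1},\qquad \mu^{n+1}=\mathcal L\phi^{n+1}+\sum_{i=1}^k b_i^{r_i^n,\phi^n},$$ $$\frac{\ln(r_i^{n+1})-\ln(r_i^n)}{\Delta t}=\frac1C\left(b_i^{r_i^n,\phi^n},\frac{\phi^{n+1}-\phi^n}{\Delta t}\right),\quad i=1,\dots,k.$$ This scheme is linear (the equations for $\phi^{n+1},\mu^{n+1}$ are linear in these unknowns, and $\ln r_i^{n+1}$ is then given explicitly), first-order accurate in time (substituting a sufficiently regular solution of the continuous system given in the context, evaluated at the corresponding times, leaves a residual $O(\Delta t)$ in each equation, uniformly in $n$), and unconditionally energy stable: for every $\Delta t>0$ and every solution of the scheme, $$\frac1{\Delta t}\left[E^{n+1}_{ME-SAV-1st}-E^n_{ME-SAV-1st}\right]\le(\mathcal G\mu^{n+1},\mu^{n+1})-\frac1{2\Delta t}\left(\phi^{n+1}-\phi^n,\mathcal L(\phi^{n+1}-\phi^n)\right)\le0,$$ where $E^n_{ME-SAV-1st}=\frac12(\phi^n,\mathcal L\phi^n)+C\sum_{i=1}^k\ln(r_i^n)$. (B) Consider the second-order (Crank–Nicolson) ME-SAV scheme: given $\phi^n$, $r_i^n>0$ and the explicit approximations $\widetilde\phi^{n+\frac12},\widetilde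 r_i^{n+\frac12}$, find $\phi^{n+1},\mu^{n+\frac12}$ and $r_i^{n+1}>0$ such that $$\frac{\phi^{n+1}-\phi^n}{\Delta t}=\mathcal G\mu^{n+\frac12},\qquad \mu^{n+\frac12}=\mathcal L\frac{\phi^{n+1}+\phi^n}{2}+\sum_{i=1}^k b_i^{\widetilde r_i^{n+\frac12},\widetilde\phi^{n+\frac12}},$$ $$\frac{\ln(r_i^{n+1})-\ln(r_i^n)}{\Delta t}=\frac1C\left(b_i^{\widetilde r_i^{n+\frac12},\widetilde\phi^{n+\frac12}},\frac{\phi^{n+1}-\phi^n}{\Delta t}\right),\quad i=1,\dots,k.$$ This scheme is linear (in the same sense as in (A)), second-order accurate in time (substituting a sufficiently regular solution of the continuous system, evaluated at the corresponding times, with $\widetilde\phi^{n+\frac12},\widetilde r_i^{n+\frac12}$ being $O(\Delta t^2)$ approximations of $\phi(t^{n+\frac12}),r_i(t^{n+\frac12})$, leaves a residual $O(\Delta t^2)$ in each equation, uniformly in $n$), and unconditionally energy stable: for every $\Delta t>0$ and every solution of the scheme, $$\frac1{\Delta t}\left[E^{n+1}_{ME-SAV-CN}-E^n_{ME-SAV-CN}\right]\le(\mathcal G\mu^{n+\frac12},\mu^{n+\frac12})\le0,$$ where $E^n_{ME-SAV-CN}=\frac12(\phi^n,\mathcal L\phi^n)+C\sum_{i=1}^k\ln(r_i^n)$.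
   Context: $\Omega$ is a bounded spatial domain, $(\cdot,\cdot)$ is the real $L^2(\Omega)$ inner product, and periodic (or homogeneous Neumann) boundary conditions are imposed. $\mathcal L$ is a symmetric non-negative linear operator: $(\mathcal Lu,v)=(u,\mathcal Lv)$ and $(\mathcal Lu,u)\ge0$. $\mathcal G$ is a non-positive linear operator: $(\mathcal G\psi,\psi)\le0$ (for example $\mathcal G=-I$ or $\mathcal G=\Delta$). All functions are assumed to lie in the domains of the operators applied to them. $F_1,\dots,F_k:\mathbb R\to\mathbb R$ are smooth energy densities. For a real number $r$ and a function $\phi$ set $$b_i^{r,\phi}=\frac{r}{\exp\left(\frac1C\int_\Omega F_i(\phi)\,d\mathbf x\right)}F_i'(\phi).$$ The continuous system, with unknown functions $\phi(\mathbf x,t),\mu(\mathbf x,t)$ and scalars $r_i(t)=\exp\left(\frac1C\int_\Omega F_i(\phi)\,d\mathbf x\right)>0$, is $$\phi_t=\mathcal G\mu,\qquad \mu=\mathcal L\phi+\sum_{i=1}^k b_i^{r_i,\phi},\qquad \frac{d\ln r_i}{dt}=\frac1C(b_i^{r_i,\phi},\phi_t),\quad i=1,\dots,k.$$ Time discretization: $\Delta t=T/N$, $t^n=n\Delta t$, $t^{n+\frac12}=(n+\tfrac12)\Delta t$, with $r_i^0=\exp\left(\frac1C\int_\Omega F_i(\phi^0)\,d\mathbf x\right)$. The quantities $\widetilde\phi^{n+\frac12}$ and $\widetilde r_i^{n+\frac12}$ are any explicit (computed from already known data) $O(\Delta t^2)$ approximations of $\phi(t^{n+\frac12})$ and $r_i(t^{n+\frac12})$;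 for $n\ge1$ the choice made is $\widetilde\phi^{n+\frac12}=\frac32\phi^n-\frac12\phi^{n-1}$ and $\widetilde r_i^{n+\frac12}=\frac32r_i^n-\frac12r_i^{n-1}$. "Sufficiently regular" means that $\phi,\mathcal L\phi,\mu,\mathcal G\mu,r_i$ have as many continuous, bounded time derivatives as needed for Taylor expansion. *)

theory Defs
  imports "HOL-Analysis.Analysis"
begin

section \<open>Functions and operators on the domain\<close>

text \<open>
  Functions on \<open>\<Omega>\<close> are represented by total functions; values outside \<open>\<Omega>\<close> are irrelevant, and
  identities between functions are meant almost everywhere in \<open>\<Omega>\<close>, as in \<open>L\<^sup>2(\<Omega>)\<close>.
\<close>

definition spatial_domain :: "'a::euclidean_space set \<Rightarrow> bool" where
  "spatial_domain \<Omega> \<longleftrightarrow> open \<Omega> \<and> connected \<Omega> \<and> bounded \<Omega> \<and> \<Omega> \<noteq> {}"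

definition l2_space :: "'a::euclidean_space set \<Rightarrow> ('a \<Rightarrow> real) set" where
  "l2_space \<Omega> =
     {u. u \<in> borel_measurable (lebesgue_on \<Omega>) \<and> integrable (lebesgue_on \<Omega>) (\<lambda>x. (u x)\<^sup>2)}"

definition l2_inner :: "'a::euclidean_space set \<Rightarrow> ('a \<Rightarrow> real) \<Rightarrow> ('a \<Rightarrow> real) \<Rightarrow> real" where
  "l2_inner \<Omega> u v = (LINT x|lebesgue_on \<Omega>. u x * v x)"

text \<open>
  A possibly unbounded linear operator on \<open>L\<^sup>2(\<Omega>)\<close> with domain \<open>D\<close>.  Boundary conditions are part of
  \<open>D\<close>.  The function \<open>w\<close> in the last clause makes the operator compatible with almost everywhere
  equality as well as linear.
\<close>

definition linear_operator ::
  "'a::euclidean_space set \<Rightarrow> ('a \<Rightarrow> real) set \<Rightarrow> (('a \<Rightarrow> real) \<Rightarrow> 'a \<Rightarrow> real) \<Rightarrow> bool" where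
  "linear_operator \<Omega> D A \<longleftrightarrow>
     D \<subseteq> l2_space \<Omega> \<and> (\<lambda>x. 0) \<in> D \<and>
     (\<forall>u\<in>D. \<forall>v\<in>D. \<forall>a b. (\<lambda>x. a * u x + b * v x) \<in> D) \<and>
     (\<forall>u\<in>D. A u \<in> l2_space \<Omega>) \<and>
     (\<forall>u\<in>D. \<forall>v\<in>D. \<forall>w\<in>D. \<forall>a b.
        (AE x in lebesgue_on \<Omega>. w x = a * u x + b * v x) \<longrightarrow>
        (AE x in lebesgue_on \<Omega>. A w x = a * A u x + b * A v x))"

definition symmetric_nonneg ::
  "'a::euclidean_space set \<Rightarrow> ('a \<Rightarrow> real) set \<Rightarrow> (('a \<Rightarrow> real) \<Rightarrow> 'a \<Rightarrow> real) \<Rightarrow> bool" where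
  "symmetric_nonneg \<Omega> D A \<longleftrightarrow>
     (\<forall>u\<in>D. \<forall>v\<in>D. l2_inner \<Omega> (A u) v = l2_inner \<Omega> u (A v)) \<and>
     (\<forall>u\<in>D. 0 \<le> l2_inner \<Omega> (A u) u)"

definition nonpositive ::
  "'a::euclidean_space set \<Rightarrow> ('a \<Rightarrow> real) set \<Rightarrow> (('a \<Rightarrow> real) \<Rightarrow> 'a \<Rightarrow> real) \<Rightarrow> bool" where
  "nonpositive \<Omega> D A \<longleftrightarrow> (\<forall>\<psi>\<in>D. l2_inner \<Omega> (A \<psi>) \<psi> \<le> 0)"

definition smooth_fun :: "(real \<Rightarrow> real) \<Rightarrow> bool" where
  "smooth_fun f \<longleftrightarrow> (\<forall>m x. (deriv ^^ m) f field_differentiable at x)"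

text \<open>
  An equation \<open>R u v = 0\<close> is linear in the unknowns \<open>u \<in> U\<close>, \<open>v \<in> V\<close> if it has the form \<open>A u v = f\<close>
  with \<open>A\<close> linear in the pair \<open>(u, v)\<close> and \<open>f\<close> independent of the unknowns.
\<close>

definition jointly_linear ::
  "'a::euclidean_space set \<Rightarrow> ('a \<Rightarrow> real) set \<Rightarrow> ('a \<Rightarrow> real) set \<Rightarrow>
    (('a \<Rightarrow> real) \<Rightarrow> ('a \<Rightarrow> real) \<Rightarrow> 'a \<Rightarrow> real) \<Rightarrow> bool" where
  "jointly_linear \<Omega> U V A \<longleftrightarrow>
     (\<forall>u\<^sub>1\<in>U. \<forall>u\<^sub>2\<in>U. \<forall>v\<^sub>1\<in>V. \<forall>v\<^sub>2\<in>V. \<forall>a b. AE x in lebesgue_on \<Omega>.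
        A (\<lambda>y. a * u\<^sub>1 y + b * u\<^sub>2 y) (\<lambda>y. a * v\<^sub>1 y + b * v\<^sub>2 y) x = a * A u\<^sub>1 v\<^sub>1 x + b * A u\<^sub>2 v\<^sub>2 x)"

definition linear_equation ::
  "'a::euclidean_space set \<Rightarrow> ('a \<Rightarrow> real) set \<Rightarrow> ('a \<Rightarrow> real) set \<Rightarrow>
    (('a \<Rightarrow> real) \<Rightarrow> ('a \<Rightarrow> real) \<Rightarrow> 'a \<Rightarrow> real) \<Rightarrow> bool" where
  "linear_equation \<Omega> U V R \<longleftrightarrow>
     (\<exists>A f. jointly_linear \<Omega> U V A \<and>
        (\<forall>u\<in>U. \<forall>v\<in>V. AE x in lebesgue_on \<Omega>. R u v x = A u v x - f x))"

section \<open>The continuous system\<close>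

definition sav_b ::
  "'a::euclidean_space set \<Rightarrow> real \<Rightarrow> (real \<Rightarrow> real) \<Rightarrow> real \<Rightarrow> ('a \<Rightarrow> real) \<Rightarrow> 'a \<Rightarrow> real" where
  "sav_b \<Omega> C f r \<phi> =
     (\<lambda>x. r / exp ((1 / C) * (LINT y|lebesgue_on \<Omega>. f (\<phi> y))) * deriv f (\<phi> x))"

text \<open>The function \<open>\<phi>\<^sub>t\<close> below is the time derivative of \<open>\<phi>\<close>, one-sided at the end points.\<close>

definition continuous_solution ::
  "'a::euclidean_space set \<Rightarrow> ('a \<Rightarrow> real) set \<Rightarrow> (('a \<Rightarrow> real) \<Rightarrow> 'a \<Rightarrow> real) \<Rightarrow>
    ('a \<Rightarrow> real) set \<Rightarrow> (('a \<Rightarrow> real) \<Rightarrow> 'a \<Rightarrow> real) \<Rightarrow> real \<Rightarrow> nat \<Rightarrow> (nat \<Rightarrow> real \<Rightarrow> real) \<Rightarrow> real \<Rightarrow>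
    (real \<Rightarrow> 'a \<Rightarrow> real) \<Rightarrow> (real \<Rightarrow> 'a \<Rightarrow> real) \<Rightarrow> (nat \<Rightarrow> real \<Rightarrow> real) \<Rightarrow> bool" where
  "continuous_solution \<Omega> D\<^sub>L L D\<^sub>G G C k F T \<phi> \<mu> r \<longleftrightarrow>
     (\<exists>\<phi>\<^sub>t. \<forall>t\<in>{0..T}.
        \<phi> t \<in> D\<^sub>L \<and> \<mu> t \<in> D\<^sub>G \<and>
        (\<forall>i\<in>{1..k}. r i t = exp ((1 / C) * (LINT x|lebesgue_on \<Omega>. F i (\<phi> t x)))) \<and>
        (AE x in lebesgue_on \<Omega>. ((\<lambda>s. \<phi> s x) has_real_derivative \<phi>\<^sub>t t x) (at t within {0..T})) \<and>
        (AE x in lebesgue_on \<Omega>. \<phi>\<^sub>t t x = G (\<mu> t) x) \<and>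
        (AE x in lebesgue_on \<Omega>.
           \<mu> t x = L (\<phi> t) x + (\<Sum>i=1..k. sav_b \<Omega> C (F i) (r i t) (\<phi> t) x)) \<and>
        (\<forall>i\<in>{1..k}. ((\<lambda>s. ln (r i s)) has_real_derivative
           (1 / C) * l2_inner \<Omega> (sav_b \<Omega> C (F i) (r i t) (\<phi> t)) (\<phi>\<^sub>t t)) (at t within {0..T})))"

text \<open>\<open>f\<close> has \<open>m\<close> continuous derivatives on \<open>[0, T]\<close>, all bounded, like \<open>f\<close> itself, by \<open>K\<close>.\<close>

definition bounded_derivs :: "nat \<Rightarrow> real \<Rightarrow> real \<Rightarrow> (real \<Rightarrow> real) \<Rightarrow> bool" where
  "bounded_derivs m T K f \<longleftrightarrow>
     (\<exists>d :: nat \<Rightarrow> real \<Rightarrow> real.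
        (\<forall>t\<in>{0..T}. d 0 t = f t) \<and>
        (\<forall>j<m. \<forall>t\<in>{0..T}. (d j has_real_derivative d (Suc j) t) (at t within {0..T})) \<and>
        continuous_on {0..T} (d m) \<and>
        (\<forall>j\<le>m. \<forall>t\<in>{0..T}. \<bar>d j t\<bar> \<le> K))"

definition time_regular ::
  "'a::euclidean_space set \<Rightarrow> nat \<Rightarrow> real \<Rightarrow> (real \<Rightarrow> 'a \<Rightarrow> real) \<Rightarrow> bool" where
  "time_regular \<Omega> m T u \<longleftrightarrow> (\<exists>K. AE x in lebesgue_on \<Omega>. bounded_derivs m T K (\<lambda>t. u t x))"

text \<open>
  The regularity used for consistency of order \<open>p\<close>: the Taylor expansion of a difference quotient
  takes one more derivative than that of a value.
\<close>

definition sufficiently_regular ::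
  "'a::euclidean_space set \<Rightarrow> (('a \<Rightarrow> real) \<Rightarrow> 'a \<Rightarrow> real) \<Rightarrow> (('a \<Rightarrow> real) \<Rightarrow> 'a \<Rightarrow> real) \<Rightarrow> nat \<Rightarrow>
    nat \<Rightarrow> real \<Rightarrow> (real \<Rightarrow> 'a \<Rightarrow> real) \<Rightarrow> (real \<Rightarrow> 'a \<Rightarrow> real) \<Rightarrow> (nat \<Rightarrow> real \<Rightarrow> real) \<Rightarrow> bool" where
  "sufficiently_regular \<Omega> L G k p T \<phi> \<mu> r \<longleftrightarrow>
     time_regular \<Omega> (Suc p) T \<phi> \<and>
     time_regular \<Omega> p T (\<lambda>t. L (\<phi> t)) \<and>
     time_regular \<Omega> p T \<mu> \<and>
     time_regular \<Omega> p T (\<lambda>t. G (\<mu> t)) \<and>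
     (\<forall>i\<in>{1..k}. \<exists>K. bounded_derivs (Suc p) T K (r i))"

section \<open>The schemes\<close>

text \<open>
  Each equation of a scheme is given by its residual, left-hand side minus right-hand side.  The
  argument \<open>\<psi>\<close> is where \<open>L\<close> is evaluated, \<open>\<rho>\<close> and \<open>\<eta>\<close> are the explicit values
  of the auxiliary variable and of the unknown function in the nonlinear terms.
\<close>

definition phi_residual ::
  "(('a \<Rightarrow> real) \<Rightarrow> 'a \<Rightarrow> real) \<Rightarrow> real \<Rightarrow> ('a \<Rightarrow> real) \<Rightarrow> ('a \<Rightarrow> real) \<Rightarrow> ('a \<Rightarrow> real) \<Rightarrow> 'a \<Rightarrow> real" where
  "phi_residual G dt \<phi> \<phi>' \<mu> = (\<lambda>x. (\<phi>' x - \<phi> x) / dt - G \<mu> x)"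

definition mu_residual ::
  "'a::euclidean_space set \<Rightarrow> (('a \<Rightarrow> real) \<Rightarrow> 'a \<Rightarrow> real) \<Rightarrow> real \<Rightarrow> nat \<Rightarrow> (nat \<Rightarrow> real \<Rightarrow> real) \<Rightarrow>
    (nat \<Rightarrow> real) \<Rightarrow> ('a \<Rightarrow> real) \<Rightarrow> ('a \<Rightarrow> real) \<Rightarrow> ('a \<Rightarrow> real) \<Rightarrow> 'a \<Rightarrow> real" where
  "mu_residual \<Omega> L C k F \<rho> \<eta> \<psi> \<mu> =
     (\<lambda>x. \<mu> x - (L \<psi> x + (\<Sum>i=1..k. sav_b \<Omega> C (F i) (\<rho> i) \<eta> x)))"

definition r_residual ::
  "'a::euclidean_space set \<Rightarrow> real \<Rightarrow> (real \<Rightarrow> real) \<Rightarrow> real \<Rightarrow> real \<Rightarrow> ('a \<Rightarrow> real) \<Rightarrow>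
    ('a \<Rightarrow> real) \<Rightarrow> ('a \<Rightarrow> real) \<Rightarrow> real \<Rightarrow> real \<Rightarrow> real" where
  "r_residual \<Omega> C f dt \<rho> \<eta> \<phi> \<phi>' r r' =
     (ln r' - ln r) / dt - (1 / C) * l2_inner \<Omega> (sav_b \<Omega> C f \<rho> \<eta>) (\<lambda>x. (\<phi>' x - \<phi> x) / dt)"

text \<open>The integrals and inner products in which \<open>\<eta>\<close> enters nonlinearly are well defined.\<close>

definition admissible ::
  "'a::euclidean_space set \<Rightarrow> nat \<Rightarrow> (nat \<Rightarrow> real \<Rightarrow> real) \<Rightarrow> ('a \<Rightarrow> real) \<Rightarrow> bool" where
  "admissible \<Omega> k F \<eta> \<longleftrightarrow> \<eta> \<in> l2_space \<Omega> \<and>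
     (\<forall>i\<in>{1..k}. integrable (lebesgue_on \<Omega>) (\<lambda>x. F i (\<eta> x)) \<and>
                 (\<lambda>x. deriv (F i) (\<eta> x)) \<in> l2_space \<Omega>)"

definition me_sav_1st ::
  "'a::euclidean_space set \<Rightarrow> ('a \<Rightarrow> real) set \<Rightarrow> (('a \<Rightarrow> real) \<Rightarrow> 'a \<Rightarrow> real) \<Rightarrow>
    ('a \<Rightarrow> real) set \<Rightarrow> (('a \<Rightarrow> real) \<Rightarrow> 'a \<Rightarrow> real) \<Rightarrow> real \<Rightarrow> nat \<Rightarrow> (nat \<Rightarrow> real \<Rightarrow> real) \<Rightarrow> real \<Rightarrow>
    ('a \<Rightarrow> real) \<Rightarrow> (nat \<Rightarrow> real) \<Rightarrow> ('a \<Rightarrow> real) \<Rightarrow> ('a \<Rightarrow> real) \<Rightarrow> (nat \<Rightarrow> real) \<Rightarrow> bool" where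
  "me_sav_1st \<Omega> D\<^sub>L L D\<^sub>G G C k F dt \<phi> r \<phi>' \<mu> r' \<longleftrightarrow>
     \<phi>' \<in> D\<^sub>L \<and> \<mu> \<in> D\<^sub>G \<and> (\<forall>i\<in>{1..k}. 0 < r' i) \<and>
     (AE x in lebesgue_on \<Omega>. phi_residual G dt \<phi> \<phi>' \<mu> x = 0) \<and>
     (AE x in lebesgue_on \<Omega>. mu_residual \<Omega> L C k F r \<phi> \<phi>' \<mu> x = 0) \<and>
     (\<forall>i\<in>{1..k}. r_residual \<Omega> C (F i) dt (r i) \<phi> \<phi> \<phi>' (r i) (r' i) = 0)"

definition midpoint_fun :: "('a \<Rightarrow> real) \<Rightarrow> ('a \<Rightarrow> real) \<Rightarrow> 'a \<Rightarrow> real" where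
  "midpoint_fun \<phi> \<phi>' = (\<lambda>x. (\<phi>' x + \<phi> x) / 2)"

definition me_sav_cn ::
  "'a::euclidean_space set \<Rightarrow> ('a \<Rightarrow> real) set \<Rightarrow> (('a \<Rightarrow> real) \<Rightarrow> 'a \<Rightarrow> real) \<Rightarrow>
    ('a \<Rightarrow> real) set \<Rightarrow> (('a \<Rightarrow> real) \<Rightarrow> 'a \<Rightarrow> real) \<Rightarrow> real \<Rightarrow> nat \<Rightarrow> (nat \<Rightarrow> real \<Rightarrow> real) \<Rightarrow> real \<Rightarrow>
    ('a \<Rightarrow> real) \<Rightarrow> (nat \<Rightarrow> real) \<Rightarrow> ('a \<Rightarrow> real) \<Rightarrow> (nat \<Rightarrow> real) \<Rightarrow>
    ('a \<Rightarrow> real) \<Rightarrow> ('a \<Rightarrow> real) \<Rightarrow> (nat \<Rightarrow> real) \<Rightarrow> bool" where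
  "me_sav_cn \<Omega> D\<^sub>L L D\<^sub>G G C k F dt \<phi> r \<eta> \<rho> \<phi>' \<mu> r' \<longleftrightarrow>
     \<phi>' \<in> D\<^sub>L \<and> \<mu> \<in> D\<^sub>G \<and> (\<forall>i\<in>{1..k}. 0 < r' i) \<and>
     (AE x in lebesgue_on \<Omega>. phi_residual G dt \<phi> \<phi>' \<mu> x = 0) \<and>
     (AE x in lebesgue_on \<Omega>. mu_residual \<Omega> L C k F \<rho> \<eta> (midpoint_fun \<phi> \<phi>') \<mu> x = 0) \<and>
     (\<forall>i\<in>{1..k}. r_residual \<Omega> C (F i) dt (\<rho> i) \<eta> \<phi> \<phi>' (r i) (r' i) = 0)"

text \<open>The discrete energy has the same form for both schemes.\<close>

definition me_sav_energy ::
  "'a::euclidean_space set \<Rightarrow> (('a \<Rightarrow> real) \<Rightarrow> 'a \<Rightarrow> real) \<Rightarrow> real \<Rightarrow> nat \<Rightarrow>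
    ('a \<Rightarrow> real) \<Rightarrow> (nat \<Rightarrow> real) \<Rightarrow> real" where
  "me_sav_energy \<Omega> L C k \<phi> r = (1 / 2) * l2_inner \<Omega> \<phi> (L \<phi>) + C * (\<Sum>i=1..k. ln (r i))"

end

theory Submission
  imports Defs
begin

text \<open>
  The nonlinear terms of both schemes are evaluated at known data.  This makes the equations for
  the new \<open>\<phi>\<close> and \<open>\<mu>\<close> linear, and the equation for \<open>ln r\<close> explicit once the new \<open>\<phi>\<close> is known.

  Energy stability comes from an identity.  Let \<open>d\<close> be the increment of \<open>\<phi>\<close> in one step.  The inner
  product of the first equation with \<open>\<mu>\<close> and of the second with \<open>d\<close> give two expressions for \<open>(d, \<mu>)\<close>,
  and the inner products of \<open>d\<close> with the nonlinear terms, which have no sign, are precisely the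
  increments of \<open>C ln r\<close> prescribed by the third equation (\<open>discrete_energy_identity\<close>).
  There remains \<open>(d, L \<psi>)\<close>, where \<open>\<psi>\<close> is the new \<open>\<phi>\<close> or the midpoint.  Symmetry of \<open>L\<close> makes it the
  increment of \<open>(\<phi>, L \<phi>) / 2\<close>, plus \<open>(d, L d) / 2\<close> in the first case
  (\<open>symmetric_difference_of_squares\<close>).  No smallness of the time step is involved.

  For consistency, the key point is that an exact solution has \<open>r = exp (1/C \<integral> F(\<phi>))\<close>, so its
  nonlinear terms are \<open>F'(\<phi>)\<close>.  Since \<open>\<phi>\<close> is bounded and \<open>F\<close> is smooth, perturbing the arguments of
  the nonlinear terms by \<open>e\<close> changes them by \<open>O(e)\<close>, uniformly (\<open>sav_b_perturb\<close>).  Each residual is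
  then compared with the exact equation at one reference time.  What remains are Taylor remainders:
  a difference quotient approximates the derivative at an end point to first order and at the
  midpoint to second order, and the average of two values approximates the midpoint value to second
  order.  For the third equation these expansions are applied to \<open>ln r\<close>, which inherits the
  regularity of \<open>r\<close> because \<open>r\<close> is positive (\<open>bounded_derivs_ln\<close>), and to the second factor of
  the inner product.
\<close>

section \<open>Square-integrable functions\<close>

lemma spatial_domain_lebesgue: "spatial_domain \<Omega> \<Longrightarrow> \<Omega> \<in> sets lebesgue"
  unfolding spatial_domain_def using lmeasurable_open fmeasurableD by blast

lemma finite_measure_spatial_domain: "spatial_domain \<Omega> \<Longrightarrow> finite_measure (lebesgue_on \<Omega>)"
  unfolding spatial_domain_def
  by (intro finite_measure_lebesgue_on lmeasurable_open) auto

text \<open>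
  Lebesgue measure is complete, so measurability passes to almost everywhere equal functions.
  This makes the time derivative of an exact solution measurable, which is only known to agree
  almost everywhere with \<open>G \<mu>\<close>.
\<close>

lemma borel_measurable_lebesgue_on_AE:
  fixes f g :: "'a::euclidean_space \<Rightarrow> real"
  assumes S: "S \<in> sets lebesgue" and f: "f \<in> borel_measurable (lebesgue_on S)"
    and ae: "AE x in lebesgue_on S. f x = g x"
  shows "g \<in> borel_measurable (lebesgue_on S)"
proof -
  have "(\<lambda>x. if x \<in> S then f x else 0) \<in> borel_measurable lebesgue"
    using borel_measurable_if[OF S] f by blast
  moreover have "AE x in lebesgue. (if x \<in> S then f x else 0) = (if x \<in> S then g x else 0)"
    using ae S by (auto simp: AE_restrict_space_iff elim: eventually_mono)
  ultimately have "(\<lambda>x. if x \<in> S then g x else 0) \<in> borel_measurable lebesgue"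
    by (rule borel_measurable_AE)
  then show ?thesis
    using borel_measurable_if[OF S] by blast
qed

lemma l2_space_measurable: "u \<in> l2_space \<Omega> \<Longrightarrow> u \<in> borel_measurable (lebesgue_on \<Omega>)"
  by (simp add: l2_space_def)

lemma l2_space_integrable_mult:
  assumes u: "u \<in> l2_space \<Omega>" and v: "v \<in> l2_space \<Omega>"
  shows "integrable (lebesgue_on \<Omega>) (\<lambda>x. u x * v x)"
proof (rule Bochner_Integration.integrable_bound)
  show "integrable (lebesgue_on \<Omega>) (\<lambda>x. (u x)\<^sup>2 + (v x)\<^sup>2)"
    using u v by (auto simp: l2_space_def)
  show "(\<lambda>x. u x * v x) \<in> borel_measurable (lebesgue_on \<Omega>)"
    using u v by (auto simp: l2_space_def)
  show "AE x in lebesgue_on \<Omega>. norm (u x * v x) \<le> norm ((u x)\<^sup>2 + (v x)\<^sup>2)"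
  proof (rule AE_I2)
    fix x
    have "0 \<le> (\<bar>u x\<bar> - \<bar>v x\<bar>)\<^sup>2" by simp
    then have "2 * (\<bar>u x\<bar> * \<bar>v x\<bar>) \<le> (u x)\<^sup>2 + (v x)\<^sup>2"
      by (simp add: power2_diff)
    moreover have "0 \<le> \<bar>u x\<bar> * \<bar>v x\<bar>" by simp
    ultimately have "\<bar>u x\<bar> * \<bar>v x\<bar> \<le> (u x)\<^sup>2 + (v x)\<^sup>2" by linarith
    then show "norm (u x * v x) \<le> norm ((u x)\<^sup>2 + (v x)\<^sup>2)"
      by (simp add: abs_mult)
  qed
qed

lemma l2_space_lincomb:
  assumes u: "u \<in> l2_space \<Omega>" and v: "v \<in> l2_space \<Omega>"
  shows "(\<lambda>x. a * u x + b * v x) \<in> l2_space \<Omega>"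
proof -
  have "integrable (lebesgue_on \<Omega>) (\<lambda>x. a\<^sup>2 * (u x)\<^sup>2 + 2 * a * b * (u x * v x) + b\<^sup>2 * (v x)\<^sup>2)"
    using l2_space_integrable_mult[OF u v] u v by (auto simp: l2_space_def)
  moreover have "(\<lambda>x. a\<^sup>2 * (u x)\<^sup>2 + 2 * a * b * (u x * v x) + b\<^sup>2 * (v x)\<^sup>2)
      = (\<lambda>x. (a * u x + b * v x)\<^sup>2)"
    by (auto simp: power2_eq_square algebra_simps)
  ultimately show ?thesis
    using u v by (auto simp: l2_space_def)
qed

lemma l2_space_cmult: "u \<in> l2_space \<Omega> \<Longrightarrow> (\<lambda>x. a * u x) \<in> l2_space \<Omega>"
  using l2_space_lincomb[of u \<Omega> u a 0] by simp

lemma l2_space_add: "u \<in> l2_space \<Omega> \<Longrightarrow> v \<in> l2_space \<Omega> \<Longrightarrow> (\<lambda>x. u x + v x) \<in> l2_space \<Omega>"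
  using l2_space_lincomb[of u \<Omega> v 1 1] by simp

lemma l2_space_diff: "u \<in> l2_space \<Omega> \<Longrightarrow> v \<in> l2_space \<Omega> \<Longrightarrow> (\<lambda>x. u x - v x) \<in> l2_space \<Omega>"
  using l2_space_lincomb[of u \<Omega> v 1 "-1"] by simp

lemma l2_space_sum:
  "(\<And>i. i \<in> I \<Longrightarrow> f i \<in> l2_space \<Omega>) \<Longrightarrow> (\<lambda>x. \<Sum>i\<in>I. f i x) \<in> l2_space \<Omega>"
proof (induction I rule: infinite_finite_induct)
  case (insert i I)
  then show ?case
    using l2_space_lincomb[of "f i" \<Omega> "\<lambda>x. \<Sum>i\<in>I. f i x" 1 1] by simp
qed (auto simp: l2_space_def)

lemma bounded_l2_space:
  assumes "finite_measure (lebesgue_on \<Omega>)" "u \<in> borel_measurable (lebesgue_on \<Omega>)"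
    and bound: "AE x in lebesgue_on \<Omega>. \<bar>u x\<bar> \<le> B"
  shows "u \<in> l2_space \<Omega>"
proof -
  have "AE x in lebesgue_on \<Omega>. norm ((u x)\<^sup>2) \<le> B\<^sup>2"
    using bound by eventually_elim (metis abs_ge_zero norm_power power_mono real_norm_def)
  then have "integrable (lebesgue_on \<Omega>) (\<lambda>x. (u x)\<^sup>2)"
    by (intro finite_measure.integrable_const_bound[OF assms(1), where B="B\<^sup>2"]) (use assms in auto)
  then show ?thesis
    using assms by (simp add: l2_space_def)
qed

lemma l2_inner_commute: "l2_inner \<Omega> u v = l2_inner \<Omega> v u"
  by (simp add: l2_inner_def mult.commute)

lemma l2_inner_scale_right: "l2_inner \<Omega> u (\<lambda>x. v x / a) = l2_inner \<Omega> u v / a"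
  by (simp add: l2_inner_def)

lemma l2_inner_lincomb_right:
  assumes "u \<in> l2_space \<Omega>" "v \<in> l2_space \<Omega>" "w \<in> l2_space \<Omega>"
  shows "l2_inner \<Omega> u (\<lambda>x. a * v x + b * w x) = a * l2_inner \<Omega> u v + b * l2_inner \<Omega> u w"
proof -
  have "l2_inner \<Omega> u (\<lambda>x. a * v x + b * w x)
      = (LINT x|lebesgue_on \<Omega>. a * (u x * v x) + b * (u x * w x))"
    unfolding l2_inner_def by (simp add: algebra_simps)
  also have "\<dots> = a * l2_inner \<Omega> u v + b * l2_inner \<Omega> u w"
    unfolding l2_inner_def using assms by (simp add: l2_space_integrable_mult)
  finally show ?thesis .
qed

lemma l2_inner_add_right:
  "u \<in> l2_space \<Omega> \<Longrightarrow> v \<in> l2_space \<Omega> \<Longrightarrow> w \<in> l2_space \<Omega> \<Longrightarrow>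
    l2_inner \<Omega> u (\<lambda>x. v x + w x) = l2_inner \<Omega> u v + l2_inner \<Omega> u w"
  using l2_inner_lincomb_right[of u \<Omega> v w 1 1] by simp

lemma l2_inner_diff_right:
  "u \<in> l2_space \<Omega> \<Longrightarrow> v \<in> l2_space \<Omega> \<Longrightarrow> w \<in> l2_space \<Omega> \<Longrightarrow>
    l2_inner \<Omega> u (\<lambda>x. v x - w x) = l2_inner \<Omega> u v - l2_inner \<Omega> u w"
  using l2_inner_lincomb_right[of u \<Omega> v w 1 "-1"] by simp

lemma l2_inner_sum_right:
  assumes u: "u \<in> l2_space \<Omega>" and f: "\<And>i. i \<in> I \<Longrightarrow> f i \<in> l2_space \<Omega>"
  shows "l2_inner \<Omega> u (\<lambda>x. \<Sum>i\<in>I. f i x) = (\<Sum>i\<in>I. l2_inner \<Omega> u (f i))"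
proof -
  have "l2_inner \<Omega> u (\<lambda>x. \<Sum>i\<in>I. f i x) = (LINT x|lebesgue_on \<Omega>. (\<Sum>i\<in>I. u x * f i x))"
    by (simp add: l2_inner_def sum_distrib_left)
  also have "\<dots> = (\<Sum>i\<in>I. l2_inner \<Omega> u (f i))"
    unfolding l2_inner_def using f u
    by (intro Bochner_Integration.integral_sum) (auto intro: l2_space_integrable_mult)
  finally show ?thesis .
qed

lemma l2_inner_cong_AE:
  assumes "u \<in> borel_measurable (lebesgue_on \<Omega>)" "v \<in> borel_measurable (lebesgue_on \<Omega>)"
    "w \<in> borel_measurable (lebesgue_on \<Omega>)" and ae: "AE x in lebesgue_on \<Omega>. v x = w x"
  shows "l2_inner \<Omega> u v = l2_inner \<Omega> u w"
  unfolding l2_inner_def using ae by (intro integral_cong_AE) (use assms in auto)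

lemma integral_diff_bound:
  fixes f g :: "'a::euclidean_space \<Rightarrow> real"
  assumes fin: "finite_measure (lebesgue_on \<Omega>)"
    and f: "integrable (lebesgue_on \<Omega>) f" and g: "integrable (lebesgue_on \<Omega>) g"
    and bound: "AE x in lebesgue_on \<Omega>. \<bar>f x - g x\<bar> \<le> B"
  shows "\<bar>(LINT x|lebesgue_on \<Omega>. f x) - (LINT x|lebesgue_on \<Omega>. g x)\<bar>
    \<le> measure (lebesgue_on \<Omega>) (space (lebesgue_on \<Omega>)) * B"
proof -
  interpret finite_measure "lebesgue_on \<Omega>" by (rule fin)
  have "\<bar>(LINT x|lebesgue_on \<Omega>. f x) - (LINT x|lebesgue_on \<Omega>. g x)\<bar>
      = \<bar>LINT x|lebesgue_on \<Omega>. f x - g x\<bar>"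
    using f g by simp
  also have "\<dots> \<le> (LINT x|lebesgue_on \<Omega>. \<bar>f x - g x\<bar>)"
    by (rule integral_abs_bound)
  also have "\<dots> \<le> (LINT x|lebesgue_on \<Omega>. B)"
    using bound f g by (intro integral_mono_AE) auto
  finally show ?thesis by simp
qed

text \<open>
  The splitting \<open>u' v' - u v = (u' - u) v' + u (v' - v)\<close> bounds the error of an inner product by
  the errors of its factors; uniform bounds on one function from each pair suffice on a domain
  of finite measure.
\<close>

lemma l2_inner_perturb:
  assumes fin: "finite_measure (lebesgue_on \<Omega>)"
    and l2: "u \<in> l2_space \<Omega>" "u' \<in> l2_space \<Omega>" "v \<in> l2_space \<Omega>" "v' \<in> l2_space \<Omega>"
    and bounds: "AE x in lebesgue_on \<Omega>. \<bar>u x\<bar> \<le> A" "AE x in lebesgue_on \<Omega>. \<bar>v' x\<bar> \<le> B"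
    and diffs: "AE x in lebesgue_on \<Omega>. \<bar>u' x - u x\<bar> \<le> a" "AE x in lebesgue_on \<Omega>. \<bar>v' x - v x\<bar> \<le> b"
  shows "\<bar>l2_inner \<Omega> u' v' - l2_inner \<Omega> u v\<bar>
    \<le> measure (lebesgue_on \<Omega>) (space (lebesgue_on \<Omega>)) * (a * B + A * b)"
  unfolding l2_inner_def
proof (rule integral_diff_bound[OF fin l2_space_integrable_mult l2_space_integrable_mult])
  show "AE x in lebesgue_on \<Omega>. \<bar>u' x * v' x - u x * v x\<bar> \<le> a * B + A * b"
    using bounds diffs
  proof eventually_elim
    case (elim x)
    have "u' x * v' x - u x * v x = (u' x - u x) * v' x + u x * (v' x - v x)"
      by (simp add: algebra_simps)
    also have "\<bar>\<dots>\<bar> \<le> \<bar>u' x - u x\<bar> * \<bar>v' x\<bar> + \<bar>u x\<bar> * \<bar>v' x - v x\<bar>"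
      by (metis abs_mult abs_triangle_ineq)
    also have "\<dots> \<le> a * B + A * b"
      using elim by (intro add_mono mult_mono) auto
    finally show ?case .
  qed
qed (use l2 in auto)

section \<open>Linearity of the schemes\<close>

lemma linear_operatorD:
  assumes "linear_operator \<Omega> D A"
  shows "D \<subseteq> l2_space \<Omega>"
    and "\<And>u v a b. u \<in> D \<Longrightarrow> v \<in> D \<Longrightarrow> (\<lambda>x. a * u x + b * v x) \<in> D"
    and "\<And>u. u \<in> D \<Longrightarrow> A u \<in> l2_space \<Omega>"
    and "\<And>u v a b. u \<in> D \<Longrightarrow> v \<in> D \<Longrightarrow>
      AE x in lebesgue_on \<Omega>. A (\<lambda>x. a * u x + b * v x) x = a * A u x + b * A v x"
proof -
  show dom: "(\<lambda>x. a * u x + b * v x) \<in> D" if "u \<in> D" "v \<in> D" for u v a b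
    using assms that unfolding linear_operator_def by blast
  have compat: "\<forall>u\<in>D. \<forall>v\<in>D. \<forall>w\<in>D. \<forall>a b.
      (AE x in lebesgue_on \<Omega>. w x = a * u x + b * v x) \<longrightarrow>
      (AE x in lebesgue_on \<Omega>. A w x = a * A u x + b * A v x)"
    using assms unfolding linear_operator_def by (elim conjE) assumption
  show "AE x in lebesgue_on \<Omega>. A (\<lambda>x. a * u x + b * v x) x = a * A u x + b * A v x"
    if "u \<in> D" "v \<in> D" for u v a b
    by (rule compat[rule_format, OF that dom[OF that]]) simp
qed (use assms in \<open>auto simp: linear_operator_def\<close>)

text \<open>
  \<open>L\<close> is applied to a midpoint as a single function in the Crank--Nicolson scheme; linearity up to
  null sets turns this into the average of two values of \<open>L\<close>.
\<close>

lemma linear_operator_midpoint: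
  assumes A: "linear_operator \<Omega> D A" and u: "u \<in> D" and v: "v \<in> D"
  shows "midpoint_fun u v \<in> D"
    and "AE x in lebesgue_on \<Omega>. A (midpoint_fun u v) x = (A v x + A u x) / 2"
proof -
  have eq: "midpoint_fun u v = (\<lambda>x. (1 / 2) * v x + (1 / 2) * u x)"
    by (auto simp: midpoint_fun_def field_simps)
  show "midpoint_fun u v \<in> D"
    unfolding eq by (rule linear_operatorD(2)[OF A v u])
  show "AE x in lebesgue_on \<Omega>. A (midpoint_fun u v) x = (A v x + A u x) / 2"
    unfolding eq using linear_operatorD(4)[OF A v u, of "1/2" "1/2"]
    by eventually_elim (simp add: field_simps)
qed

text \<open>
  The known functions enter only the inhomogeneous part: here \<open>\<phi> / dt\<close>, and in the equations for
  \<open>\<mu>\<close> the nonlinear terms, because these are evaluated at explicit data \<open>\<rho>\<close>, \<open>\<eta>\<close>, joined by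
  \<open>L \<phi> / 2\<close> in the midpoint version.
\<close>

lemma phi_equation_linear:
  assumes G: "linear_operator \<Omega> V G"
  shows "linear_equation \<Omega> U V (\<lambda>\<phi>' \<mu>. phi_residual G dt \<phi> \<phi>' \<mu>)"
  unfolding linear_equation_def
proof (intro exI conjI)
  show "jointly_linear \<Omega> U V (\<lambda>u v x. u x / dt - G v x)"
    unfolding jointly_linear_def
  proof (intro ballI allI)
    fix u1 u2 v1 v2 :: "'a \<Rightarrow> real" and a b :: real
    assume "v1 \<in> V" "v2 \<in> V"
    from linear_operatorD(4)[OF G this, of a b]
    show "AE x in lebesgue_on \<Omega>. (a * u1 x + b * u2 x) / dt - G (\<lambda>y. a * v1 y + b * v2 y) x
        = a * (u1 x / dt - G v1 x) + b * (u2 x / dt - G v2 x)"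
      by eventually_elim (simp add: add_divide_distrib algebra_simps)
  qed
  show "\<forall>u\<in>U. \<forall>v\<in>V. AE x in lebesgue_on \<Omega>.
      phi_residual G dt \<phi> u v x = u x / dt - G v x - \<phi> x / dt"
    by (simp add: phi_residual_def diff_divide_distrib)
qed

lemma mu_equation_linear:
  assumes L: "linear_operator \<Omega> U L"
  shows "linear_equation \<Omega> U V (\<lambda>\<phi>' \<mu>. mu_residual \<Omega> L C k F \<rho> \<eta> \<phi>' \<mu>)"
  unfolding linear_equation_def
proof (intro exI conjI)
  show "jointly_linear \<Omega> U V (\<lambda>u v x. v x - L u x)"
    unfolding jointly_linear_def
  proof (intro ballI allI)
    fix u1 u2 v1 v2 :: "'a \<Rightarrow> real" and a b :: real
    assume "u1 \<in> U" "u2 \<in> U"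
    from linear_operatorD(4)[OF L this, of a b]
    show "AE x in lebesgue_on \<Omega>. (a * v1 x + b * v2 x) - L (\<lambda>y. a * u1 y + b * u2 y) x
        = a * (v1 x - L u1 x) + b * (v2 x - L u2 x)"
      by eventually_elim (simp add: algebra_simps)
  qed
  show "\<forall>u\<in>U. \<forall>v\<in>V. AE x in lebesgue_on \<Omega>.
      mu_residual \<Omega> L C k F \<rho> \<eta> u v x = v x - L u x - (\<Sum>i=1..k. sav_b \<Omega> C (F i) (\<rho> i) \<eta> x)"
    by (simp add: mu_residual_def)
qed

lemma mu_midpoint_equation_linear:
  assumes L: "linear_operator \<Omega> U L" and \<phi>: "\<phi> \<in> U"
  shows "linear_equation \<Omega> U V (\<lambda>\<phi>' \<mu>. mu_residual \<Omega> L C k F \<rho> \<eta> (midpoint_fun \<phi> \<phi>') \<mu>)"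
  unfolding linear_equation_def
proof (intro exI conjI)
  show "jointly_linear \<Omega> U V (\<lambda>u v x. v x - L u x / 2)"
    unfolding jointly_linear_def
  proof (intro ballI allI)
    fix u1 u2 v1 v2 :: "'a \<Rightarrow> real" and a b :: real
    assume "u1 \<in> U" "u2 \<in> U"
    from linear_operatorD(4)[OF L this, of a b]
    show "AE x in lebesgue_on \<Omega>. (a * v1 x + b * v2 x) - L (\<lambda>y. a * u1 y + b * u2 y) x / 2
        = a * (v1 x - L u1 x / 2) + b * (v2 x - L u2 x / 2)"
      by eventually_elim (simp add: field_simps)
  qed
  show "\<forall>u\<in>U. \<forall>v\<in>V. AE x in lebesgue_on \<Omega>.
      mu_residual \<Omega> L C k F \<rho> \<eta> (midpoint_fun \<phi> u) v x
        = v x - L u x / 2 - (L \<phi> x / 2 + (\<Sum>i=1..k. sav_b \<Omega> C (F i) (\<rho> i) \<eta> x))"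
  proof (intro ballI)
    fix u v assume "u \<in> U"
    from linear_operator_midpoint(2)[OF L \<phi> this]
    show "AE x in lebesgue_on \<Omega>. mu_residual \<Omega> L C k F \<rho> \<eta> (midpoint_fun \<phi> u) v x
        = v x - L u x / 2 - (L \<phi> x / 2 + (\<Sum>i=1..k. sav_b \<Omega> C (F i) (\<rho> i) \<eta> x))"
      by eventually_elim (simp add: mu_residual_def field_simps)
  qed
qed

lemma r_residual_eq_0_iff:
  assumes "dt > 0"
  shows "r_residual \<Omega> C f dt \<rho> \<eta> \<phi> \<phi>' r r' = 0 \<longleftrightarrow>
    ln r' = ln r + (1 / C) * l2_inner \<Omega> (sav_b \<Omega> C f \<rho> \<eta>) (\<lambda>x. \<phi>' x - \<phi> x)"
proof -
  have "r_residual \<Omega> C f dt \<rho> \<eta> \<phi> \<phi>' r r'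
      = (ln r' - ln r - (1 / C) * l2_inner \<Omega> (sav_b \<Omega> C f \<rho> \<eta>) (\<lambda>x. \<phi>' x - \<phi> x)) / dt"
    unfolding r_residual_def l2_inner_scale_right by (simp add: diff_divide_distrib)
  then show ?thesis using assms by auto
qed

section \<open>Energy stability\<close>

lemma sav_b_l2_space:
  "admissible \<Omega> k F \<eta> \<Longrightarrow> i \<in> {1..k} \<Longrightarrow> sav_b \<Omega> C (F i) \<rho> \<eta> \<in> l2_space \<Omega>"
  unfolding sav_b_def admissible_def by (intro l2_space_cmult) blast

text \<open>
  The identity behind both stability estimates.  Testing the first equation with \<open>\<mu>\<close> and the second
  with the increment of \<open>\<phi>\<close> expresses \<open>(\<phi>' - \<phi>, \<mu>)\<close> in two ways.  The sum of the inner products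
  of the increment with the nonlinear terms has no sign, but the update of \<open>ln r\<close> is chosen
  so that it is exactly \<open>C\<close> times the sum of the increments of \<open>ln r\<close>.  The point \<open>\<psi>\<close> is \<open>\<phi>'\<close> for the
  first-order scheme and the midpoint for the Crank--Nicolson scheme.
\<close>

lemma discrete_energy_identity:
  assumes L: "linear_operator \<Omega> D\<^sub>L L" and G: "linear_operator \<Omega> D\<^sub>G G"
    and adm: "admissible \<Omega> k F \<eta>" and dt: "dt > 0" and C: "C > 0"
    and dom: "\<phi> \<in> D\<^sub>L" "\<phi>' \<in> D\<^sub>L" "\<psi> \<in> D\<^sub>L" "\<mu> \<in> D\<^sub>G"
    and phi: "AE x in lebesgue_on \<Omega>. phi_residual G dt \<phi> \<phi>' \<mu> x = 0"
    and mu: "AE x in lebesgue_on \<Omega>. mu_residual \<Omega> L C k F \<rho> \<eta> \<psi> \<mu> x = 0"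
    and r: "\<forall>i\<in>{1..k}. r_residual \<Omega> C (F i) dt (\<rho> i) \<eta> \<phi> \<phi>' (r i) (r' i) = 0"
  shows "l2_inner \<Omega> (\<lambda>x. \<phi>' x - \<phi> x) (L \<psi>) + C * (\<Sum>i=1..k. ln (r' i)) - C * (\<Sum>i=1..k. ln (r i))
    = dt * l2_inner \<Omega> (G \<mu>) \<mu>"
proof -
  let ?d = "\<lambda>x. \<phi>' x - \<phi> x" and ?b = "\<lambda>i. sav_b \<Omega> C (F i) (\<rho> i) \<eta>"
  have d: "?d \<in> l2_space \<Omega>" and \<mu>: "\<mu> \<in> l2_space \<Omega>"
    using dom linear_operatorD(1)[OF L] linear_operatorD(1)[OF G] by (auto intro: l2_space_diff)
  have L\<psi>: "L \<psi> \<in> l2_space \<Omega>" and G\<mu>: "G \<mu> \<in> l2_space \<Omega>"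
    using dom linear_operatorD(3)[OF L] linear_operatorD(3)[OF G] by auto
  have b: "?b i \<in> l2_space \<Omega>" if "i \<in> {1..k}" for i
    using sav_b_l2_space[OF adm that] .
  have S: "(\<lambda>x. \<Sum>i=1..k. ?b i x) \<in> l2_space \<Omega>"
    using b by (rule l2_space_sum)
  have "dt * l2_inner \<Omega> (G \<mu>) \<mu> = l2_inner \<Omega> \<mu> (\<lambda>x. dt * G \<mu> x + 0 * G \<mu> x)"
    unfolding l2_inner_lincomb_right[OF \<mu> G\<mu> G\<mu>] by (simp add: l2_inner_commute)
  also have "\<dots> = l2_inner \<Omega> \<mu> ?d"
  proof (rule l2_inner_cong_AE)
    show "AE x in lebesgue_on \<Omega>. dt * G \<mu> x + 0 * G \<mu> x = \<phi>' x - \<phi> x"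
      using phi by eventually_elim (use dt in \<open>simp add: phi_residual_def field_simps\<close>)
  qed (use \<mu> d l2_space_lincomb[OF G\<mu> G\<mu>, of dt 0] in \<open>auto simp: l2_space_measurable\<close>)
  also have "\<dots> = l2_inner \<Omega> ?d \<mu>"
    by (rule l2_inner_commute)
  also have "\<dots> = l2_inner \<Omega> ?d (\<lambda>x. L \<psi> x + (\<Sum>i=1..k. ?b i x))"
  proof (rule l2_inner_cong_AE)
    show "AE x in lebesgue_on \<Omega>. \<mu> x = L \<psi> x + (\<Sum>i=1..k. ?b i x)"
      using mu by eventually_elim (simp add: mu_residual_def)
  qed (use \<mu> d L\<psi> S in \<open>auto intro!: l2_space_measurable l2_space_add\<close>)
  also have "\<dots> = l2_inner \<Omega> ?d (L \<psi>) + (\<Sum>i=1..k. l2_inner \<Omega> ?d (?b i))"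
    using d L\<psi> S b by (simp only: l2_inner_add_right l2_inner_sum_right)
  also have "(\<Sum>i=1..k. l2_inner \<Omega> ?d (?b i)) = (\<Sum>i=1..k. C * (ln (r' i) - ln (r i)))"
  proof (rule sum.cong[OF refl])
    fix i assume "i \<in> {1..k}"
    with r have "r_residual \<Omega> C (F i) dt (\<rho> i) \<eta> \<phi> \<phi>' (r i) (r' i) = 0"
      by blast
    then have "ln (r' i) = ln (r i) + (1 / C) * l2_inner \<Omega> ?d (?b i)"
      unfolding r_residual_eq_0_iff[OF dt] by (simp add: l2_inner_commute)
    then show "l2_inner \<Omega> ?d (?b i) = C * (ln (r' i) - ln (r i))"
      using C by simp
  qed
  finally show ?thesis
    by (simp add: sum_subtractf right_diff_distrib flip: sum_distrib_left)
qed

text \<open>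
  Symmetry identifies the two cross terms \<open>(u, L v)\<close> and \<open>(v, L u)\<close>.  The first two equations give
  \<open>2 (v - u, L v) = (v, L v) - (u, L u) + (v - u, L (v - u))\<close>, whose last term is the numerical
  dissipation of the implicit Euler step; evaluating \<open>L\<close> at the midpoint removes that term.
\<close>

lemma symmetric_difference_of_squares:
  assumes L: "linear_operator \<Omega> D L" and sym: "symmetric_nonneg \<Omega> D L" and dom: "u \<in> D" "v \<in> D"
  shows "l2_inner \<Omega> (\<lambda>x. v x - u x) (L (\<lambda>x. v x - u x))
      = l2_inner \<Omega> v (L v) - 2 * l2_inner \<Omega> u (L v) + l2_inner \<Omega> u (L u)"
    and "l2_inner \<Omega> (\<lambda>x. v x - u x) (L v) = l2_inner \<Omega> v (L v) - l2_inner \<Omega> u (L v)"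
    and "l2_inner \<Omega> (\<lambda>x. v x - u x) (L (midpoint_fun u v))
      = (l2_inner \<Omega> v (L v) - l2_inner \<Omega> u (L u)) / 2"
proof -
  have l2: "u \<in> l2_space \<Omega>" "v \<in> l2_space \<Omega>" "L u \<in> l2_space \<Omega>" "L v \<in> l2_space \<Omega>"
    using dom linear_operatorD(1,3)[OF L] by auto
  have d: "(\<lambda>x. v x - u x) \<in> D" and d2: "(\<lambda>x. v x - u x) \<in> l2_space \<Omega>"
    using linear_operatorD(2)[OF L dom(2,1), of 1 "-1"] l2 by (auto intro: l2_space_diff)
  have cross: "l2_inner \<Omega> v (L u) = l2_inner \<Omega> u (L v)"
    using sym dom l2_inner_commute unfolding symmetric_nonneg_def by metis
  have diff: "l2_inner \<Omega> (\<lambda>x. v x - u x) w = l2_inner \<Omega> v w - l2_inner \<Omega> u w"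
    if "w \<in> l2_space \<Omega>" for w
    using l2_inner_diff_right[OF that l2(2,1)] by (simp add: l2_inner_commute)
  show "l2_inner \<Omega> (\<lambda>x. v x - u x) (L v) = l2_inner \<Omega> v (L v) - l2_inner \<Omega> u (L v)"
    by (rule diff[OF l2(4)])
  have "l2_inner \<Omega> (\<lambda>x. v x - u x) (L (\<lambda>x. v x - u x))
      = l2_inner \<Omega> (\<lambda>x. v x - u x) (\<lambda>x. L v x - L u x)"
  proof (rule l2_inner_cong_AE)
    show "AE x in lebesgue_on \<Omega>. L (\<lambda>x. v x - u x) x = L v x - L u x"
      using linear_operatorD(4)[OF L dom(2,1), of 1 "-1"] by simp
  qed (use d d2 l2 linear_operatorD(3)[OF L d] in
      \<open>auto intro: l2_space_measurable borel_measurable_diff\<close>)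
  also have "\<dots> = l2_inner \<Omega> v (L v) - 2 * l2_inner \<Omega> u (L v) + l2_inner \<Omega> u (L u)"
    using l2 d2 cross by (simp add: l2_inner_diff_right diff)
  finally show "l2_inner \<Omega> (\<lambda>x. v x - u x) (L (\<lambda>x. v x - u x))
      = l2_inner \<Omega> v (L v) - 2 * l2_inner \<Omega> u (L v) + l2_inner \<Omega> u (L u)" .
  have "l2_inner \<Omega> (\<lambda>x. v x - u x) (L (midpoint_fun u v))
      = l2_inner \<Omega> (\<lambda>x. v x - u x) (\<lambda>x. (1 / 2) * L v x + (1 / 2) * L u x)"
  proof (rule l2_inner_cong_AE)
    show "AE x in lebesgue_on \<Omega>. L (midpoint_fun u v) x = (1 / 2) * L v x + (1 / 2) * L u x"
      using linear_operator_midpoint(2)[OF L dom] by eventually_elim (simp add: field_simps)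
    show "L (midpoint_fun u v) \<in> borel_measurable (lebesgue_on \<Omega>)"
      using linear_operatorD(3)[OF L linear_operator_midpoint(1)[OF L dom]]
      by (rule l2_space_measurable)
  qed (use d2 l2 in \<open>auto intro: l2_space_measurable l2_space_lincomb simp del: times_divide_eq_left\<close>)
  also have "\<dots> = (l2_inner \<Omega> v (L v) - l2_inner \<Omega> u (L u)) / 2"
    unfolding l2_inner_lincomb_right[OF d2 l2(4,3)] using l2 cross
    by (simp add: diff field_simps)
  finally show "l2_inner \<Omega> (\<lambda>x. v x - u x) (L (midpoint_fun u v))
      = (l2_inner \<Omega> v (L v) - l2_inner \<Omega> u (L u)) / 2" .
qed

text \<open>
  Implicit Euler dissipates through two terms: the quadratic form of \<open>G\<close> at \<open>\<mu>\<close>, and that of \<open>L\<close> on the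
  increment, which is the remainder of the difference of squares.
\<close>

lemma me_sav_1st_energy_stable:
  assumes L: "linear_operator \<Omega> D\<^sub>L L" and sym: "symmetric_nonneg \<Omega> D\<^sub>L L"
    and G: "linear_operator \<Omega> D\<^sub>G G" and neg: "nonpositive \<Omega> D\<^sub>G G"
    and C: "C > 0" and dt: "dt > 0" and \<phi>: "\<phi> \<in> D\<^sub>L" and adm: "admissible \<Omega> k F \<phi>"
    and scheme: "me_sav_1st \<Omega> D\<^sub>L L D\<^sub>G G C k F dt \<phi> r \<phi>' \<mu> r'"
  shows "(1 / dt) * (me_sav_energy \<Omega> L C k \<phi>' r' - me_sav_energy \<Omega> L C k \<phi> r)
      = l2_inner \<Omega> (G \<mu>) \<mu>
         - (1 / (2 * dt)) * l2_inner \<Omega> (\<lambda>x. \<phi>' x - \<phi> x) (L (\<lambda>x. \<phi>' x - \<phi> x))" (is ?identity)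
    and "l2_inner \<Omega> (G \<mu>) \<mu>
         - (1 / (2 * dt)) * l2_inner \<Omega> (\<lambda>x. \<phi>' x - \<phi> x) (L (\<lambda>x. \<phi>' x - \<phi> x)) \<le> 0" (is ?dissipation)
proof -
  have \<phi>': "\<phi>' \<in> D\<^sub>L" and \<mu>: "\<mu> \<in> D\<^sub>G"
    using scheme by (auto simp: me_sav_1st_def)
  have eq: "l2_inner \<Omega> (\<lambda>x. \<phi>' x - \<phi> x) (L \<phi>') + C * (\<Sum>i=1..k. ln (r' i)) - C * (\<Sum>i=1..k. ln (r i))
      = dt * l2_inner \<Omega> (G \<mu>) \<mu>"
    using scheme \<phi>
    by (intro discrete_energy_identity[OF L G adm dt C]) (auto simp: me_sav_1st_def)
  note sq = symmetric_difference_of_squares[OF L sym \<phi> \<phi>']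
  have "me_sav_energy \<Omega> L C k \<phi>' r' - me_sav_energy \<Omega> L C k \<phi> r
      = dt * l2_inner \<Omega> (G \<mu>) \<mu> - l2_inner \<Omega> (\<lambda>x. \<phi>' x - \<phi> x) (L (\<lambda>x. \<phi>' x - \<phi> x)) / 2"
    using eq sq(1,2) by (simp add: me_sav_energy_def field_simps)
  then show ?identity
    using dt by (simp only: right_diff_distrib) (simp add: field_simps)
  have "(\<lambda>x. \<phi>' x - \<phi> x) \<in> D\<^sub>L"
    using linear_operatorD(2)[OF L \<phi>' \<phi>, of 1 "-1"] by simp
  then have "0 \<le> l2_inner \<Omega> (\<lambda>x. \<phi>' x - \<phi> x) (L (\<lambda>x. \<phi>' x - \<phi> x))"
    using sym l2_inner_commute unfolding symmetric_nonneg_def by metis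
  moreover have "l2_inner \<Omega> (G \<mu>) \<mu> \<le> 0"
    using neg \<mu> by (simp add: nonpositive_def)
  ultimately show ?dissipation
    using dt by (simp add: divide_nonneg_pos order_trans[of _ 0])
qed

lemma me_sav_cn_energy_stable:
  assumes L: "linear_operator \<Omega> D\<^sub>L L" and sym: "symmetric_nonneg \<Omega> D\<^sub>L L"
    and G: "linear_operator \<Omega> D\<^sub>G G" and neg: "nonpositive \<Omega> D\<^sub>G G"
    and C: "C > 0" and dt: "dt > 0" and \<phi>: "\<phi> \<in> D\<^sub>L" and adm: "admissible \<Omega> k F \<eta>"
    and scheme: "me_sav_cn \<Omega> D\<^sub>L L D\<^sub>G G C k F dt \<phi> r \<eta> \<rho> \<phi>' \<mu> r'"
  shows "(1 / dt) * (me_sav_energy \<Omega> L C k \<phi>' r' - me_sav_energy \<Omega> L C k \<phi> r) = l2_inner \<Omega> (G \<mu>) \<mu>"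
      (is ?identity)
    and "l2_inner \<Omega> (G \<mu>) \<mu> \<le> 0" (is ?dissipation)
proof -
  have \<phi>': "\<phi>' \<in> D\<^sub>L" and \<mu>: "\<mu> \<in> D\<^sub>G"
    using scheme by (auto simp: me_sav_cn_def)
  have "l2_inner \<Omega> (\<lambda>x. \<phi>' x - \<phi> x) (L (midpoint_fun \<phi> \<phi>'))
        + C * (\<Sum>i=1..k. ln (r' i)) - C * (\<Sum>i=1..k. ln (r i)) = dt * l2_inner \<Omega> (G \<mu>) \<mu>"
    using scheme \<phi> linear_operator_midpoint(1)[OF L \<phi> \<phi>']
    by (intro discrete_energy_identity[OF L G adm dt C]) (auto simp: me_sav_cn_def)
  then show ?identity
    using dt symmetric_difference_of_squares(3)[OF L sym \<phi> \<phi>']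
    by (simp add: me_sav_energy_def field_simps)
  show ?dissipation
    using neg \<mu> by (simp add: nonpositive_def)
qed

section \<open>Taylor estimates in time\<close>

text \<open>
  The derivatives that witness boundedness agree with \<open>f\<close> only on \<open>[0, T]\<close>.  Replacing the one of
  order zero by \<open>f\<close> itself keeps its derivative within the interval and gives an equation between
  functions.
\<close>

lemma bounded_derivsE:
  assumes "bounded_derivs m T K f"
  obtains d where "d 0 = f"
    and "\<And>j t. j < m \<Longrightarrow> t \<in> {0..T} \<Longrightarrow> (d j has_real_derivative d (Suc j) t) (at t within {0..T})"
    and "\<And>j t. j \<le> m \<Longrightarrow> t \<in> {0..T} \<Longrightarrow> \<bar>d j t\<bar> \<le> K"
    and "\<And>j. j \<le> m \<Longrightarrow> continuous_on {0..T} (d j)"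
proof -
  obtain d where d: "(\<forall>t\<in>{0..T}. d 0 t = f t) \<and>
      (\<forall>j<m. \<forall>t\<in>{0..T}. (d j has_real_derivative d (Suc j) t) (at t within {0..T})) \<and>
      continuous_on {0..T} (d m) \<and> (\<forall>j\<le>m. \<forall>t\<in>{0..T}. \<bar>d j t\<bar> \<le> K)"
    using assms unfolding bounded_derivs_def by (rule exE)
  have d0: "\<And>t. t \<in> {0..T} \<Longrightarrow> d 0 t = f t"
    and deriv: "\<And>j t. j < m \<Longrightarrow> t \<in> {0..T} \<Longrightarrow> (d j has_real_derivative d (Suc j) t) (at t within {0..T})"
    and cont: "continuous_on {0..T} (d m)"
    and bound: "\<And>j t. j \<le> m \<Longrightarrow> t \<in> {0..T} \<Longrightarrow> \<bar>d j t\<bar> \<le> K"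
    using d by blast+
  define e where "e j = (if j = 0 then f else d j)" for j :: nat
  have e: "e j t = d j t" if "t \<in> {0..T}" for j t
    using d0 that by (simp add: e_def)
  have deriv': "(e j has_real_derivative e (Suc j) t) (at t within {0..T})"
    if "j < m" "t \<in> {0..T}" for j t
    unfolding e[OF that(2)]
    by (rule has_field_derivative_transform_within[OF deriv[OF that], where d=1]) (use e that in auto)
  have cont': "continuous_on {0..T} (e j)" if "j \<le> m" for j
  proof (cases "j = m")
    case True
    with cont e show ?thesis by (subst continuous_on_cong[OF refl, of _ _ "d m"]) auto
  next
    case False
    with that have "j < m" by simp
    then have "continuous (at t within {0..T}) (e j)" if "t \<in> {0..T}" for t
      using deriv'[OF _ that] by (intro DERIV_continuous)
    then show ?thesis
      by (simp add: continuous_on_eq_continuous_within)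
  qed
  have e0: "e 0 = f"
    by (simp add: e_def)
  have bound': "\<bar>e j t\<bar> \<le> K" if "j \<le> m" "t \<in> {0..T}" for j t
    using bound[OF that] e[OF that(2)] by simp
  show thesis
    using e0 deriv' bound' cont' by (rule that)
qed

lemma bounded_derivs_mono:
  assumes "bounded_derivs m T K f" "n \<le> m" "K \<le> K'"
  shows "bounded_derivs n T K' f"
proof -
  obtain d where "d 0 = f"
    "\<And>j t. j < m \<Longrightarrow> t \<in> {0..T} \<Longrightarrow> (d j has_real_derivative d (Suc j) t) (at t within {0..T})"
    "\<And>j t. j \<le> m \<Longrightarrow> t \<in> {0..T} \<Longrightarrow> \<bar>d j t\<bar> \<le> K"
    "\<And>j. j \<le> m \<Longrightarrow> continuous_on {0..T} (d j)"
    by (rule bounded_derivsE[OF assms(1)]) (rule that, assumption+)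
  with assms(2,3) show ?thesis
    unfolding bounded_derivs_def by (intro exI[of _ d]) (auto intro: order_trans[of _ K])
qed

lemma bounded_derivs_bound: "bounded_derivs m T K f \<Longrightarrow> t \<in> {0..T} \<Longrightarrow> \<bar>f t\<bar> \<le> K"
  by (erule bounded_derivsE) (metis le0)

text \<open>
  The differential equations provide some derivative of the solution at a given time; uniqueness
  identifies it with the one that occurs in a Taylor expansion.
\<close>

lemma has_real_derivative_unique_within_Icc:
  assumes "(f has_real_derivative D) (at t within {0..T})"
    and "(f has_real_derivative D') (at t within {0..T})"
    and "t \<in> {0..T}" "0 < T"
  shows "D = D'"
  using assms vector_derivative_unique_within_closed_interval[of 0 T t f D D']
  by (simp add: has_real_derivative_iff_has_vector_derivative)

lemma bounded_derivs_lipschitz: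
  assumes f: "bounded_derivs 1 T K f" and s: "s \<in> {0..T}" and t: "t \<in> {0..T}"
  shows "\<bar>f t - f s\<bar> \<le> K * \<bar>t - s\<bar>"
proof -
  obtain d where d: "d 0 = f"
    "\<And>j t. j < 1 \<Longrightarrow> t \<in> {0..T} \<Longrightarrow> (d j has_real_derivative d (Suc j) t) (at t within {0..T})"
    "\<And>j t. j \<le> 1 \<Longrightarrow> t \<in> {0..T} \<Longrightarrow> \<bar>d j t\<bar> \<le> K"
    by (rule bounded_derivsE[OF f]) (rule that, assumption+)
  have "norm (d 0 t - (\<Sum>i\<le>0. d i s * (t - s) ^ i / fact i)) \<le> K * norm (t - s) ^ Suc 0 / fact 0"
    by (rule field_Taylor[where S="{0..T}"]) (use d s t in auto)
  with d(1) s t show ?thesis by simp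
qed

lemma bounded_derivs_taylor_1:
  assumes f: "bounded_derivs 2 T K f" and s: "s \<in> {0..T}" and t: "t \<in> {0..T}" and T: "0 < T"
    and D: "(f has_real_derivative D) (at s within {0..T})"
  shows "\<bar>f t - f s - (t - s) * D\<bar> \<le> K * (t - s)\<^sup>2"
proof -
  obtain d where d: "d 0 = f"
    "\<And>j t. j < 2 \<Longrightarrow> t \<in> {0..T} \<Longrightarrow> (d j has_real_derivative d (Suc j) t) (at t within {0..T})"
    "\<And>j t. j \<le> 2 \<Longrightarrow> t \<in> {0..T} \<Longrightarrow> \<bar>d j t\<bar> \<le> K"
    by (rule bounded_derivsE[OF f]) (rule that, assumption+)
  have "D = d 1 s"
    using d(1) d(2)[of 0] D s T by (auto intro: has_real_derivative_unique_within_Icc)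
  moreover have "norm (d 0 t - (\<Sum>i\<le>1. d i s * (t - s) ^ i / fact i)) \<le> K * norm (t - s) ^ Suc 1 / fact 1"
    by (rule field_Taylor[where S="{0..T}"]) (use d s t in \<open>auto simp: numeral_2_eq_2\<close>)
  ultimately show ?thesis
    using d(1) s t by (simp add: algebra_simps power2_eq_square flip: abs_mult)
qed

text \<open>
  Expanding to second order about the centre, the terms of even order cancel in the difference;
  this is where the Crank--Nicolson difference quotient gains an order.
\<close>

lemma central_difference:
  assumes f: "bounded_derivs 3 T K f" and T: "0 < T"
    and c: "c \<in> {0..T}" "c - h \<in> {0..T}" "c + h \<in> {0..T}" and h: "0 \<le> h"
    and D: "(f has_real_derivative D) (at c within {0..T})"
  shows "\<bar>f (c + h) - f (c - h) - 2 * h * D\<bar> \<le> K * h ^ 3"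
proof -
  obtain d where d: "d 0 = f"
    "\<And>j t. j < 3 \<Longrightarrow> t \<in> {0..T} \<Longrightarrow> (d j has_real_derivative d (Suc j) t) (at t within {0..T})"
    "\<And>j t. j \<le> 3 \<Longrightarrow> t \<in> {0..T} \<Longrightarrow> \<bar>d j t\<bar> \<le> K"
    by (rule bounded_derivsE[OF f]) (rule that, assumption+)
  have D1: "D = d 1 c"
    using d(1) d(2)[of 0] D c T by (auto intro: has_real_derivative_unique_within_Icc)
  have taylor: "\<bar>f t - (f c + D * (t - c) + d 2 c * (t - c)\<^sup>2 / 2)\<bar> \<le> K * \<bar>t - c\<bar> ^ 3 / 2"
    if "t \<in> {0..T}" for t
  proof -
    have "norm (d 0 t - (\<Sum>i\<le>2. d i c * (t - c) ^ i / fact i)) \<le> K * norm (t - c) ^ Suc 2 / fact 2"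
      by (rule field_Taylor[where S="{0..T}"]) (use d c that in \<open>auto simp: numeral_3_eq_3\<close>)
    moreover have "{..2::nat} = {0, 1, 2}" by auto
    ultimately show ?thesis
      using d(1) that c(1) D1 by (simp add: numeral_3_eq_3 add.assoc)
  qed
  have "\<bar>f (c + h) - (f c + D * h + d 2 c * h\<^sup>2 / 2)\<bar> \<le> K * h ^ 3 / 2"
    "\<bar>f (c - h) - (f c - D * h + d 2 c * h\<^sup>2 / 2)\<bar> \<le> K * h ^ 3 / 2"
    using taylor[OF c(3)] taylor[OF c(2)] h by simp_all
  then show ?thesis by (simp add: field_simps)
qed

lemma bounded_derivs_has_derivative:
  assumes "bounded_derivs m T K f" "0 < m" "t \<in> {0..T}"
  shows "\<exists>D. (f has_real_derivative D) (at t within {0..T})"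
proof (rule bounded_derivsE[OF assms(1)])
  fix d
  assume "d 0 = f"
    and "\<And>j t. j < m \<Longrightarrow> t \<in> {0..T} \<Longrightarrow> (d j has_real_derivative d (Suc j) t) (at t within {0..T})"
  from this(1) this(2)[OF assms(2,3)]
  show "\<exists>D. (f has_real_derivative D) (at t within {0..T})" by auto
qed

text \<open>
  The same cancellation for the average, now of the first-order terms.
\<close>

lemma midpoint_average:
  assumes f: "bounded_derivs 2 T K f" and T: "0 < T"
    and c: "c \<in> {0..T}" "c - h \<in> {0..T}" "c + h \<in> {0..T}"
  shows "\<bar>(f (c + h) + f (c - h)) / 2 - f c\<bar> \<le> K * h\<^sup>2"
proof -
  obtain D where D: "(f has_real_derivative D) (at c within {0..T})"
    using bounded_derivs_has_derivative[OF f _ c(1)] by auto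
  have "\<bar>f (c + h) - f c - h * D\<bar> \<le> K * h\<^sup>2" "\<bar>f (c - h) - f c + h * D\<bar> \<le> K * h\<^sup>2"
    using bounded_derivs_taylor_1[OF f c(1) c(3) T D] bounded_derivs_taylor_1[OF f c(1) c(2) T D]
    by simp_all
  then show ?thesis by (simp add: field_simps)
qed

text \<open>
  The weights \<open>3/2\<close> and \<open>-1/2\<close> reproduce affine functions, so only the quadratic Taylor remainders at
  distances \<open>h\<close> and \<open>h / 2\<close> survive.
\<close>

lemma linear_extrapolation:
  assumes f: "bounded_derivs 2 T K f" and T: "0 < T"
    and c: "c \<in> {0..T}" "c - h \<in> {0..T}" "c + h / 2 \<in> {0..T}"
  shows "\<bar>3 / 2 * f c - 1 / 2 * f (c - h) - f (c + h / 2)\<bar> \<le> K * h\<^sup>2"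
proof -
  obtain D where D: "(f has_real_derivative D) (at c within {0..T})"
    using bounded_derivs_has_derivative[OF f _ c(1)] by auto
  have "\<bar>f (c + h / 2) - f c - h * D / 2\<bar> \<le> K * h\<^sup>2 / 4" "\<bar>f (c - h) - f c + h * D\<bar> \<le> K * h\<^sup>2"
    using bounded_derivs_taylor_1[OF f c(1) c(3) T D] bounded_derivs_taylor_1[OF f c(1) c(2) T D]
    by (simp_all add: power2_eq_square)
  then show ?thesis by linarith
qed

lemma difference_quotient_endpoint:
  assumes f: "bounded_derivs 2 T K f" and T: "0 < T" and h: "0 < h"
    and t: "t \<in> {0..T}" "t + h \<in> {0..T}" and s: "s = t \<or> s = t + h"
    and D: "(f has_real_derivative D) (at s within {0..T})"
  shows "\<bar>(f (t + h) - f t) / h - D\<bar> \<le> K * h"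
proof -
  have "\<bar>f (t + h) - f t - h * D\<bar> \<le> K * h\<^sup>2"
    using s
  proof
    assume "s = t"
    with bounded_derivs_taylor_1[OF f _ t(2) T D] t show ?thesis by simp
  next
    assume "s = t + h"
    with bounded_derivs_taylor_1[OF f _ t(1) T D] t show ?thesis
      by (simp add: abs_minus_commute algebra_simps)
  qed
  moreover have "(f (t + h) - f t) / h - D = (f (t + h) - f t - h * D) / h"
    using h by (simp add: diff_divide_distrib)
  ultimately show ?thesis
    using h by (simp add: abs_divide divide_le_eq power2_eq_square)
qed

lemma difference_quotient_midpoint:
  assumes f: "bounded_derivs 3 T K f" and T: "0 < T" and h: "0 < h"
    and t: "t \<in> {0..T}" "t + h \<in> {0..T}"
    and D: "(f has_real_derivative D) (at (t + h / 2) within {0..T})"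
  shows "\<bar>(f (t + h) - f t) / h - D\<bar> \<le> K * h\<^sup>2"
proof -
  have K: "0 \<le> K"
    using bounded_derivs_bound[OF f t(1)] by linarith
  have "\<bar>f (t + h / 2 + h / 2) - f (t + h / 2 - h / 2) - 2 * (h / 2) * D\<bar> \<le> K * (h / 2) ^ 3"
    by (rule central_difference[OF f T _ _ _ _ D]) (use t h in auto)
  then have "\<bar>f (t + h) - f t - h * D\<bar> \<le> K * h ^ 3 / 8"
    by (simp add: power_divide add.commute)
  also have "\<dots> \<le> K * h ^ 3"
    using K h by simp
  finally have "\<bar>f (t + h) - f t - h * D\<bar> \<le> K * h ^ 3" .
  moreover have "(f (t + h) - f t) / h - D = (f (t + h) - f t - h * D) / h"
    using h by (simp add: diff_divide_distrib)
  ultimately show ?thesis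
    using h by (simp add: abs_divide divide_le_eq power2_eq_square power3_eq_cube)
qed

text \<open>
  The third equation of the schemes approximates the derivative of \<open>ln r\<close>, while regularity is
  given for \<open>r\<close>.  The derivatives of \<open>ln r\<close> are polynomials in the quotients of the derivatives of \<open>r\<close>
  by \<open>r\<close>, hence continuous because \<open>r > 0\<close>, and then bounded because \<open>[0, T]\<close> is compact.
\<close>

lemma bounded_derivs_ln:
  assumes f: "bounded_derivs m T K f" and pos: "\<And>t. t \<in> {0..T} \<Longrightarrow> 0 < f t" and m: "m = 2 \<or> m = 3"
  shows "\<exists>K. bounded_derivs m T K (\<lambda>t. ln (f t))"
proof -
  obtain d where d: "d 0 = f"
    "\<And>j t. j < m \<Longrightarrow> t \<in> {0..T} \<Longrightarrow> (d j has_real_derivative d (Suc j) t) (at t within {0..T})"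
    "\<And>j t. j \<le> m \<Longrightarrow> t \<in> {0..T} \<Longrightarrow> \<bar>d j t\<bar> \<le> K"
    and cd: "\<And>j. j \<le> m \<Longrightarrow> continuous_on {0..T} (d j)"
    by (rule bounded_derivsE[OF f]) (rule that, assumption+)
  \<comment> \<open>\<open>e j\<close> is the \<open>j\<close>-th derivative of \<open>ln f\<close>, for \<open>j\<close> up to 3.\<close>
  define e :: "nat \<Rightarrow> real \<Rightarrow> real" where
    "e j = (if j = 0 then \<lambda>t. ln (d 0 t) else if j = 1 then (\<lambda>t. d 1 t / d 0 t)
      else if j = 2 then (\<lambda>t. d 2 t / d 0 t - (d 1 t / d 0 t) * (d 1 t / d 0 t))
      else (\<lambda>t. (d 3 t / d 0 t - (d 2 t / d 0 t) * (d 1 t / d 0 t))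
        - 2 * ((d 1 t / d 0 t) * (d 2 t / d 0 t - (d 1 t / d 0 t) * (d 1 t / d 0 t)))))" for j
  have e: "e 0 = (\<lambda>t. ln (d 0 t))" "e 1 = (\<lambda>t. d 1 t / d 0 t)"
    "e 2 = (\<lambda>t. d 2 t / d 0 t - (d 1 t / d 0 t) * (d 1 t / d 0 t))"
    "e 3 = (\<lambda>t. (d 3 t / d 0 t - (d 2 t / d 0 t) * (d 1 t / d 0 t))
        - 2 * ((d 1 t / d 0 t) * (d 2 t / d 0 t - (d 1 t / d 0 t) * (d 1 t / d 0 t))))"
    by (simp_all add: e_def)
  have d0: "0 < d 0 t" if "t \<in> {0..T}" for t
    using pos[OF that] by (simp only: d(1))
  have deriv: "(e j has_real_derivative e (Suc j) t) (at t within {0..T})"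
    if j: "j < m" and t: "t \<in> {0..T}" for j t
  proof -
    have d': "(d i has_real_derivative d (Suc i) t) (at t within {0..T})" if "i \<le> j" for i
      using le_less_trans[OF that j] t by (rule d(2))
    have q: "((\<lambda>t. d i t / d 0 t) has_real_derivative
        d (Suc i) t / d 0 t - (d i t / d 0 t) * (d 1 t / d 0 t)) (at t within {0..T})" if "i \<le> j" for i
      by (rule DERIV_cong[OF DERIV_divide[OF d'[OF that] d'[of 0]]])
        (use d0[OF t] in \<open>simp_all add: field_simps\<close>)
    have "j = 0 \<or> j = 1 \<or> j = 2"
      using j m by auto
    then consider "j = 0" | "j = 1" | "j = 2"
      by blast
    then show ?thesis
    proof cases
      case 1
      have "((\<lambda>t. ln (d 0 t)) has_real_derivative d 1 t / d 0 t) (at t within {0..T})"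
        by (rule DERIV_cong[OF DERIV_chain2[OF DERIV_ln_divide[OF d0[OF t]] d'[of 0]]]) simp_all
      with 1 show ?thesis
        by (simp only: e One_nat_def[symmetric])
    next
      case 2
      with q[of 1] show ?thesis
        by (simp only: e Suc_1 order.refl simp_thms)
    next
      case 3
      have three: "Suc 2 = 3" and two: "Suc 1 = 2" and le: "2 \<le> j" "1 \<le> j"
        using 3 by simp_all
      note q2 = q[OF le(1), unfolded three] and q1 = q[OF le(2), unfolded two]
      have "((\<lambda>t. d 2 t / d 0 t - (d 1 t / d 0 t) * (d 1 t / d 0 t)) has_real_derivative
          (d 3 t / d 0 t - (d 2 t / d 0 t) * (d 1 t / d 0 t))
          - 2 * ((d 1 t / d 0 t) * (d 2 t / d 0 t - (d 1 t / d 0 t) * (d 1 t / d 0 t))))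
          (at t within {0..T})"
        by (rule DERIV_cong[OF DERIV_diff[OF q2 DERIV_mult[OF q1 q1]]]) (simp add: algebra_simps)
      with 3 show ?thesis
        by (simp only: e three)
    qed
  qed
  have ce: "continuous_on {0..T} (e j)" if j: "j \<le> m" for j
  proof -
    have q: "continuous_on {0..T} (\<lambda>t. d i t / d 0 t)" if "i \<le> j" for i
    proof (rule continuous_on_divide)
      show "\<forall>t\<in>{0..T}. d 0 t \<noteq> 0" using d0 by force
    qed (use that j in \<open>auto intro: cd\<close>)
    have "j = 0 \<or> j = 1 \<or> j = 2 \<or> j = 3"
      using j m by auto
    then consider "j = 0" | "j = 1" | "j = 2" | "j = 3"
      by blast
    then show ?thesis
    proof cases
      case 1
      have "continuous_on {0..T} (\<lambda>t. ln (d 0 t))"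
        by (rule continuous_on_ln[OF cd]) (use d0 in force)+
      with 1 show ?thesis by (simp only: e)
    next
      case 2
      with q[of 1] show ?thesis by (simp only: e order.refl simp_thms)
    next
      case 3
      have "continuous_on {0..T} (\<lambda>t. d 2 t / d 0 t - (d 1 t / d 0 t) * (d 1 t / d 0 t))"
        using 3 by (intro continuous_on_diff continuous_on_mult q) simp_all
      with 3 show ?thesis by (simp only: e)
    next
      case 4
      have "continuous_on {0..T} (\<lambda>t. (d 3 t / d 0 t - (d 2 t / d 0 t) * (d 1 t / d 0 t))
        - 2 * ((d 1 t / d 0 t) * (d 2 t / d 0 t - (d 1 t / d 0 t) * (d 1 t / d 0 t))))"
        using 4 by (intro continuous_on_diff continuous_on_mult continuous_on_const q) simp_all
      with 4 show ?thesis by (simp only: e)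
    qed
  qed
  have "bounded (\<Union>j\<in>{..m}. e j ` {0..T})"
    using ce by (intro bounded_UN ballI compact_imp_bounded compact_continuous_image) auto
  then obtain B where "\<forall>y\<in>(\<Union>j\<in>{..m}. e j ` {0..T}). norm y \<le> B"
    unfolding bounded_iff by (rule exE)
  then have B: "\<bar>e j t\<bar> \<le> B" if "j \<le> m" "t \<in> {0..T}" for j t
    using that by simp
  have e0: "e 0 t = ln (f t)" for t
    by (simp only: e d(1))
  have "bounded_derivs m T B (\<lambda>t. ln (f t))"
    unfolding bounded_derivs_def
    by (intro exI[of _ e] conjI ballI allI impI) (simp_all only: e0 deriv ce B)
  then show ?thesis ..
qed

section \<open>Perturbation of the nonlinear terms\<close>

lemma smooth_fun_has_derivs:
  assumes "smooth_fun f"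
  shows "(f has_real_derivative deriv f x) (at x)"
    and "(deriv f has_real_derivative deriv (deriv f) x) (at x)"
    and "isCont (deriv (deriv f)) x"
proof -
  have *: "(deriv ^^ m) f field_differentiable at x" for m
    using assms by (simp add: smooth_fun_def)
  show "(f has_real_derivative deriv f x) (at x)"
    using *[of 0] field_differentiable_derivI by force
  show "(deriv f has_real_derivative deriv (deriv f) x) (at x)"
    using *[of 1] field_differentiable_derivI by force
  show "isCont (deriv (deriv f)) x"
    using *[of 2] field_differentiable_imp_continuous_at by (simp add: numeral_2_eq_2)
qed

lemma smooth_fun_continuous:
  assumes "smooth_fun f"
  shows "continuous_on S f" "continuous_on S (deriv f)" "continuous_on S (deriv (deriv f))"
  using smooth_fun_has_derivs[OF assms]
  by (blast intro: continuous_at_imp_continuous_on DERIV_isCont)+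

lemma smooth_fun_measurable:
  assumes "smooth_fun f" and u: "u \<in> borel_measurable M"
  shows "(\<lambda>x. f (u x)) \<in> borel_measurable M" "(\<lambda>x. deriv f (u x)) \<in> borel_measurable M"
  using smooth_fun_continuous[OF assms(1)]
  by (auto intro!: measurable_compose[OF u] borel_measurable_continuous_onI)

lemma smooth_fun_bounds:
  assumes f: "smooth_fun f"
  shows "\<exists>B\<ge>0. \<forall>y z. \<bar>y\<bar> \<le> R \<longrightarrow> \<bar>z\<bar> \<le> R \<longrightarrow> \<bar>f y\<bar> \<le> B \<and> \<bar>deriv f y\<bar> \<le> B \<and>
    \<bar>f y - f z\<bar> \<le> B * \<bar>y - z\<bar> \<and> \<bar>deriv f y - deriv f z\<bar> \<le> B * \<bar>y - z\<bar>"
proof -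
  have "bounded (f ` {-R..R} \<union> deriv f ` {-R..R} \<union> deriv (deriv f) ` {-R..R})"
    by (intro bounded_Un[THEN iffD2] conjI compact_imp_bounded compact_continuous_image
        smooth_fun_continuous[OF f] compact_Icc)
  then obtain B where "0 < B"
    and "\<forall>v \<in> f ` {-R..R} \<union> deriv f ` {-R..R} \<union> deriv (deriv f) ` {-R..R}. norm v \<le> B"
    unfolding bounded_pos by auto
  then have B: "\<bar>f y\<bar> \<le> B" "\<bar>deriv f y\<bar> \<le> B" "\<bar>deriv (deriv f) y\<bar> \<le> B" if "y \<in> {-R..R}" for y
    using that by auto
  have lip: "norm (g y - g z) \<le> B * norm (y - z)"
    if "\<And>x. (g has_real_derivative g' x) (at x)" "\<And>x. x \<in> {-R..R} \<Longrightarrow> \<bar>g' x\<bar> \<le> B"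
      "y \<in> {-R..R}" "z \<in> {-R..R}" for g g' y z
    by (rule field_differentiable_bound[where S="{-R..R}" and f'=g'])
      (use that in \<open>auto intro: has_field_derivative_at_within\<close>)
  have "\<bar>y\<bar> \<le> R \<longleftrightarrow> y \<in> {-R..R}" for y
    by auto
  then show ?thesis
    using B \<open>0 < B\<close> lip[OF smooth_fun_has_derivs(1)[OF f] B(2)]
      lip[OF smooth_fun_has_derivs(2)[OF f] B(3)]
    by (intro exI[of _ B]) auto
qed

lemma abs_exp_minus_1_le: "\<bar>exp x - 1\<bar> \<le> \<bar>x\<bar> * exp \<bar>x\<bar>" for x :: real
proof -
  have "exp x * (1 - x) \<le> exp x * exp (- x)"
    using exp_ge_add_one_self[of "- x"] by (intro mult_left_mono) auto
  then have "exp x - 1 \<le> x * exp x"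
    by (simp add: algebra_simps exp_minus)
  also have "\<dots> \<le> \<bar>x\<bar> * exp \<bar>x\<bar>"
    by (intro mult_mono) auto
  finally have "exp x - 1 \<le> \<bar>x\<bar> * exp \<bar>x\<bar>" .
  moreover have "1 - exp x \<le> \<bar>x\<bar> * 1"
    using exp_ge_add_one_self[of x] by linarith
  then have "1 - exp x \<le> \<bar>x\<bar> * exp \<bar>x\<bar>"
    by (rule order_trans) (intro mult_left_mono, auto)
  ultimately show ?thesis by linarith
qed

text \<open>
  The exact value of \<open>\<rho>\<close> cancels the exponential in the definition of the nonlinear term, which
  leaves \<open>F'(u)\<close>.  Perturbing \<open>\<rho>\<close> and \<open>u\<close> by at most \<open>e\<close> changes both the quotient and \<open>F'\<close> by \<open>O(e)\<close>, as
  all arguments stay in a compact interval.  The function \<open>u\<close> enters the constant only through its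
  bound \<open>M\<close>, and the perturbation only through an upper bound \<open>E\<close> of its size; this makes the
  consistency error uniform in time and in the step size.
\<close>

lemma sav_b_perturb:
  assumes dom: "spatial_domain \<Omega>" and C: "C > 0" and f: "smooth_fun f"
  shows "\<exists>B\<ge>0. \<forall>u\<in>l2_space \<Omega>. \<forall>\<eta>\<in>l2_space \<Omega>. \<forall>\<rho> e. 0 \<le> e \<longrightarrow> e \<le> E \<longrightarrow>
    (AE x in lebesgue_on \<Omega>. \<bar>u x\<bar> \<le> M) \<longrightarrow> (AE x in lebesgue_on \<Omega>. \<bar>\<eta> x - u x\<bar> \<le> e) \<longrightarrow>
    \<bar>\<rho> - exp ((1 / C) * (LINT x|lebesgue_on \<Omega>. f (u x)))\<bar> \<le> e \<longrightarrow>
    (AE x in lebesgue_on \<Omega>. \<bar>sav_b \<Omega> C f \<rho> \<eta> x - deriv f (u x)\<bar> \<le> B * e)"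
proof -
  let ?M = "lebesgue_on \<Omega>"
  define V where "V = measure ?M (space ?M)"
  note fin = finite_measure_spatial_domain[OF dom]
  obtain B where B0: "B \<ge> 0"
    and B: "\<And>y z. \<bar>y\<bar> \<le> M + E \<Longrightarrow> \<bar>z\<bar> \<le> M + E \<Longrightarrow> \<bar>f y\<bar> \<le> B \<and> \<bar>deriv f y\<bar> \<le> B \<and>
      \<bar>f y - f z\<bar> \<le> B * \<bar>y - z\<bar> \<and> \<bar>deriv f y - deriv f z\<bar> \<le> B * \<bar>y - z\<bar>"
    using smooth_fun_bounds[OF f, of "M + E"] by blast
  define A where "A = V * B / C"
  have A0: "0 \<le> A"
    using B0 C by (simp add: A_def V_def)
  define Q where "Q = exp A + A * exp (2 * A)"
  have Q0: "0 \<le> Q"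
    using A0 by (simp add: Q_def)
  show ?thesis
  proof (intro exI[of _ "B * (Q + 1)"] conjI ballI allI impI)
    show "0 \<le> B * (Q + 1)"
      using B0 Q0 by simp
  next
    fix u \<eta> \<rho> e
    assume u: "u \<in> l2_space \<Omega>" and \<eta>: "\<eta> \<in> l2_space \<Omega>" and e0: "0 \<le> e" and eE: "e \<le> E"
      and uM: "AE x in ?M. \<bar>u x\<bar> \<le> M" and near: "AE x in ?M. \<bar>\<eta> x - u x\<bar> \<le> e"
      and \<rho>: "\<bar>\<rho> - exp ((1 / C) * (LINT x|?M. f (u x)))\<bar> \<le> e"
    have uR: "AE x in ?M. \<bar>u x\<bar> \<le> M + E"
      using uM by eventually_elim (use e0 eE in linarith)
    have \<eta>R: "AE x in ?M. \<bar>\<eta> x\<bar> \<le> M + E"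
      using uM near by eventually_elim (use e0 eE in linarith)
    have bound: "integrable ?M (\<lambda>x. f (w x))" "\<bar>LINT x|?M. f (w x)\<bar> \<le> V * B"
      if w: "w \<in> l2_space \<Omega>" and wR: "AE x in ?M. \<bar>w x\<bar> \<le> M + E" for w
    proof -
      have fB: "AE x in ?M. \<bar>f (w x)\<bar> \<le> B"
        using wR by eventually_elim (use B in blast)
      then show int: "integrable ?M (\<lambda>x. f (w x))"
        by (intro finite_measure.integrable_const_bound[OF fin, where B=B]
            smooth_fun_measurable(1)[OF f] l2_space_measurable w) simp
      show "\<bar>LINT x|?M. f (w x)\<bar> \<le> V * B"
        using integral_diff_bound[OF fin int, of "\<lambda>_. 0" B] fB by (simp add: V_def)
    qed
    define a where "a = (1 / C) * (LINT x|?M. f (\<eta> x))"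
    define b where "b = (1 / C) * (LINT x|?M. f (u x))"
    have a: "\<bar>a\<bar> \<le> A"
      using bound(2)[OF \<eta> \<eta>R] C by (simp add: a_def b_def A_def abs_mult divide_right_mono)
    have b: "\<bar>b\<bar> \<le> A"
      using bound(2)[OF u uR] C by (simp add: a_def b_def A_def abs_mult divide_right_mono)
    have "AE x in ?M. \<bar>f (u x) - f (\<eta> x)\<bar> \<le> B * e"
      using uR \<eta>R near
    proof eventually_elim
      case (elim x)
      have "\<bar>f (u x) - f (\<eta> x)\<bar> \<le> B * \<bar>u x - \<eta> x\<bar>"
        using B elim by blast
      also have "\<dots> \<le> B * e"
        using elim B0 by (intro mult_left_mono) auto
      finally show ?case .
    qed
    from integral_diff_bound[OF fin bound(1)[OF u uR] bound(1)[OF \<eta> \<eta>R] this]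
    have int: "\<bar>(LINT x|?M. f (u x)) - (LINT x|?M. f (\<eta> x))\<bar> \<le> V * (B * e)"
      by (simp add: V_def)
    have "\<bar>b - a\<bar> = \<bar>(LINT x|?M. f (u x)) - (LINT x|?M. f (\<eta> x))\<bar> / C"
      using C by (simp add: a_def b_def abs_divide flip: diff_divide_distrib)
    also have "\<dots> \<le> V * (B * e) / C"
      using int C by (intro divide_right_mono) auto
    finally have ab: "\<bar>b - a\<bar> \<le> A * e"
      by (simp add: A_def mult.assoc)
    have "\<bar>exp (b - a) - 1\<bar> \<le> \<bar>b - a\<bar> * exp \<bar>b - a\<bar>"
      by (rule abs_exp_minus_1_le)
    also have "\<dots> \<le> (A * e) * exp (2 * A)"
      using ab a b A0 e0 by (intro mult_mono) auto
    finally have exp_part: "\<bar>exp (b - a) - 1\<bar> \<le> A * exp (2 * A) * e"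
      by (simp add: mult.commute mult.left_commute)
    \<comment> \<open>The exponential quotient is compared with 1 through
      \<open>\<rho> e\<^sup>-\<^sup>a - 1 = (\<rho> - e\<^sup>b) e\<^sup>-\<^sup>a + (e\<^sup>b\<^sup>-\<^sup>a - 1)\<close>.\<close>
    have "\<bar>(\<rho> - exp b) * exp (- a)\<bar> \<le> e * exp A"
      unfolding abs_mult using \<rho> a e0 by (intro mult_mono) (auto simp: b_def)
    moreover have "\<rho> / exp a - 1 = (\<rho> - exp b) * exp (- a) + (exp (b - a) - 1)"
      by (simp add: exp_minus exp_diff field_simps)
    ultimately have factor: "\<bar>\<rho> / exp a - 1\<bar> \<le> Q * e"
      using exp_part by (simp add: Q_def algebra_simps)
    show "AE x in ?M. \<bar>sav_b \<Omega> C f \<rho> \<eta> x - deriv f (u x)\<bar> \<le> B * (Q + 1) * e"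
      using uR \<eta>R near
    proof eventually_elim
      case (elim x)
      have "sav_b \<Omega> C f \<rho> \<eta> x - deriv f (u x)
          = (\<rho> / exp a - 1) * deriv f (\<eta> x) + (deriv f (\<eta> x) - deriv f (u x))"
        by (simp add: sav_b_def a_def algebra_simps)
      also have "\<bar>\<dots>\<bar> \<le> \<bar>\<rho> / exp a - 1\<bar> * \<bar>deriv f (\<eta> x)\<bar> + \<bar>deriv f (\<eta> x) - deriv f (u x)\<bar>"
        by (metis abs_mult abs_triangle_ineq)
      also have "\<dots> \<le> (Q * e) * B + B * e"
      proof (intro add_mono mult_mono)
        have "\<bar>deriv f (\<eta> x) - deriv f (u x)\<bar> \<le> B * \<bar>\<eta> x - u x\<bar>"
          using B elim by blast
        also have "\<dots> \<le> B * e"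
          using elim B0 by (intro mult_left_mono) auto
        finally show "\<bar>deriv f (\<eta> x) - deriv f (u x)\<bar> \<le> B * e" .
        show "\<bar>deriv f (\<eta> x)\<bar> \<le> B"
          using B elim by blast
      qed (use factor Q0 e0 in auto)
      finally show ?case
        by (simp add: algebra_simps)
    qed
  qed
qed

text \<open>
  Combines constants found separately for each of the finitely many energy densities.
\<close>

lemma uniform_bound:
  fixes P :: "'i \<Rightarrow> real \<Rightarrow> bool"
  assumes "finite I" and "\<And>i. i \<in> I \<Longrightarrow> \<exists>B. P i B"
    and mono: "\<And>i B B'. i \<in> I \<Longrightarrow> P i B \<Longrightarrow> B \<le> B' \<Longrightarrow> P i B'"
  shows "\<exists>B\<ge>0. \<forall>i\<in>I. P i B"
proof -
  obtain b where b: "\<And>i. i \<in> I \<Longrightarrow> P i (b i)"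
    using assms(2) by metis
  have "b i \<le> (\<Sum>j\<in>I. \<bar>b j\<bar>)" if "i \<in> I" for i
    using member_le_sum[of i I "\<lambda>j. \<bar>b j\<bar>"] assms(1) that by simp
  then have "\<forall>i\<in>I. P i (\<Sum>j\<in>I. \<bar>b j\<bar>)"
    using b mono by blast
  then show ?thesis
    by (intro exI[of _ "\<Sum>j\<in>I. \<bar>b j\<bar>"]) (simp add: sum_nonneg)
qed

section \<open>Consistency\<close>

text \<open>
  An exact solution that is regular enough for consistency of order \<open>p\<close>.  The constants obtained
  in this locale never depend on the position or the length of a time step, so they serve for every
  time grid.
\<close>

locale regular_sav_solution =
  fixes \<Omega> :: "'a::euclidean_space set"
    and D\<^sub>L D\<^sub>G :: "('a \<Rightarrow> real) set"
    and L G :: "('a \<Rightarrow> real) \<Rightarrow> 'a \<Rightarrow> real"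
    and C :: real and k :: nat and F :: "nat \<Rightarrow> real \<Rightarrow> real"
    and p :: nat and T :: real and \<phi> \<mu> :: "real \<Rightarrow> 'a \<Rightarrow> real" and r :: "nat \<Rightarrow> real \<Rightarrow> real"
  assumes dom: "spatial_domain \<Omega>"
    and L: "linear_operator \<Omega> D\<^sub>L L" and G: "linear_operator \<Omega> D\<^sub>G G"
    and C: "C > 0" and T: "T > 0"
    and smooth: "\<And>i. i \<in> {1..k} \<Longrightarrow> smooth_fun (F i)"
    and sol: "continuous_solution \<Omega> D\<^sub>L L D\<^sub>G G C k F T \<phi> \<mu> r"
    and reg: "sufficiently_regular \<Omega> L G k p T \<phi> \<mu> r"
    and p: "p = 1 \<or> p = 2"
begin

abbreviation "exact_b i t \<equiv> sav_b \<Omega> C (F i) (r i t) (\<phi> t)"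

abbreviation "V \<equiv> measure (lebesgue_on \<Omega>) (space (lebesgue_on \<Omega>))"

lemma fin: "finite_measure (lebesgue_on \<Omega>)"
  by (rule finite_measure_spatial_domain[OF dom])

lemma solution_at:
  assumes t: "t \<in> {0..T}"
  shows "\<phi> t \<in> D\<^sub>L \<and> \<mu> t \<in> D\<^sub>G \<and>
    (\<forall>i\<in>{1..k}. r i t = exp ((1 / C) * (LINT x|lebesgue_on \<Omega>. F i (\<phi> t x)))) \<and>
    (AE x in lebesgue_on \<Omega>. \<mu> t x = L (\<phi> t) x + (\<Sum>i=1..k. exact_b i t x)) \<and>
    (\<exists>v. (AE x in lebesgue_on \<Omega>. ((\<lambda>s. \<phi> s x) has_real_derivative v x) (at t within {0..T})) \<and>
      (AE x in lebesgue_on \<Omega>. v x = G (\<mu> t) x) \<and>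
      (\<forall>i\<in>{1..k}. ((\<lambda>s. ln (r i s)) has_real_derivative (1 / C) * l2_inner \<Omega> (exact_b i t) v)
        (at t within {0..T})))"
  by (insert sol[unfolded continuous_solution_def], erule exE, drule bspec[OF _ t], elim conjE)
    (intro conjI exI; assumption)

lemma phi_dom: "t \<in> {0..T} \<Longrightarrow> \<phi> t \<in> D\<^sub>L"
  and mu_dom: "t \<in> {0..T} \<Longrightarrow> \<mu> t \<in> D\<^sub>G"
  and r_eq: "t \<in> {0..T} \<Longrightarrow> i \<in> {1..k} \<Longrightarrow>
    r i t = exp ((1 / C) * (LINT x|lebesgue_on \<Omega>. F i (\<phi> t x)))"
  and mu_eq: "t \<in> {0..T} \<Longrightarrow>
    AE x in lebesgue_on \<Omega>. \<mu> t x = L (\<phi> t) x + (\<Sum>i=1..k. exact_b i t x)"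
  by (drule solution_at, elim conjE, (assumption | erule (1) bspec))+

lemma phi_l2: "t \<in> {0..T} \<Longrightarrow> \<phi> t \<in> l2_space \<Omega>"
  using phi_dom linear_operatorD(1)[OF L] by auto

lemma G_mu_l2: "t \<in> {0..T} \<Longrightarrow> G (\<mu> t) \<in> l2_space \<Omega>"
  using mu_dom linear_operatorD(3)[OF G] by auto

text \<open>
  On an exact solution the auxiliary variable equals the exponential it stands for, so the
  nonlinear term is the derivative of the energy density.
\<close>

lemma exact_b: "t \<in> {0..T} \<Longrightarrow> i \<in> {1..k} \<Longrightarrow> exact_b i t = (\<lambda>x. deriv (F i) (\<phi> t x))"
  by (simp add: sav_b_def r_eq)

lemma phi_derivative:
  assumes t: "t \<in> {0..T}"
  shows "AE x in lebesgue_on \<Omega>. ((\<lambda>s. \<phi> s x) has_real_derivative G (\<mu> t) x) (at t within {0..T})"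
proof -
  obtain v where
    "AE x in lebesgue_on \<Omega>. ((\<lambda>s. \<phi> s x) has_real_derivative v x) (at t within {0..T})"
    "AE x in lebesgue_on \<Omega>. v x = G (\<mu> t) x"
    using solution_at[OF t] by (elim exE conjE)
  then show ?thesis by eventually_elim simp
qed

lemma exact_b_l2:
  assumes t: "t \<in> {0..T}" and i: "i \<in> {1..k}" and M: "AE x in lebesgue_on \<Omega>. \<bar>\<phi> t x\<bar> \<le> M"
  shows "exact_b i t \<in> l2_space \<Omega>"
proof -
  obtain B where "\<And>y. \<bar>y\<bar> \<le> M \<Longrightarrow> \<bar>deriv (F i) y\<bar> \<le> B"
    using smooth_fun_bounds[OF smooth[OF i], of M] by blast
  then have "AE x in lebesgue_on \<Omega>. \<bar>deriv (F i) (\<phi> t x)\<bar> \<le> B"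
    using M by (auto elim: eventually_mono)
  then show ?thesis
    unfolding exact_b[OF t i]
    by (rule bounded_l2_space[OF fin
          smooth_fun_measurable(2)[OF smooth[OF i] l2_space_measurable[OF phi_l2[OF t]]]])
qed

lemma phi_regular:
  obtains M where "0 \<le> M" "AE x in lebesgue_on \<Omega>. bounded_derivs (Suc p) T M (\<lambda>t. \<phi> t x)"
proof -
  obtain K where "AE x in lebesgue_on \<Omega>. bounded_derivs (Suc p) T K (\<lambda>t. \<phi> t x)"
    using reg unfolding sufficiently_regular_def time_regular_def by blast
  then have "AE x in lebesgue_on \<Omega>. bounded_derivs (Suc p) T \<bar>K\<bar> (\<lambda>t. \<phi> t x)"
    by eventually_elim (erule bounded_derivs_mono, auto)
  then show thesis by (intro that[of "\<bar>K\<bar>"]) auto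
qed

lemma r_regular:
  obtains M where "0 \<le> M" "\<And>i. i \<in> {1..k} \<Longrightarrow> bounded_derivs (Suc p) T M (r i)"
    "\<And>i. i \<in> {1..k} \<Longrightarrow> bounded_derivs (Suc p) T M (\<lambda>t. ln (r i t))"
proof -
  have "\<exists>M. bounded_derivs (Suc p) T M (r i) \<and> bounded_derivs (Suc p) T M (\<lambda>t. ln (r i t))"
    if i: "i \<in> {1..k}" for i
  proof -
    obtain K where K: "bounded_derivs (Suc p) T K (r i)"
      using reg i unfolding sufficiently_regular_def by blast
    obtain K' where K': "bounded_derivs (Suc p) T K' (\<lambda>t. ln (r i t))"
      using bounded_derivs_ln[OF K] r_eq[OF _ i] p by (auto simp: numeral_3_eq_3)
    show ?thesis
      using bounded_derivs_mono[OF K order.refl max.cobounded1[of K K']]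
        bounded_derivs_mono[OF K' order.refl max.cobounded2[of K' K]] by blast
  qed
  then have "\<exists>M\<ge>0. \<forall>i\<in>{1..k}. bounded_derivs (Suc p) T M (r i)
      \<and> bounded_derivs (Suc p) T M (\<lambda>t. ln (r i t))"
    by (intro uniform_bound finite_atLeastAtMost)
      (auto intro: bounded_derivs_mono[OF _ order.refl])
  then show thesis
    using that by blast
qed

lemma ln_r_derivative:
  assumes t: "t \<in> {0..T}" and i: "i \<in> {1..k}"
  shows "((\<lambda>s. ln (r i s)) has_real_derivative (1 / C) * l2_inner \<Omega> (exact_b i t) (G (\<mu> t)))
    (at t within {0..T})"
proof -
  obtain v where eq: "AE x in lebesgue_on \<Omega>. v x = G (\<mu> t) x" and
    "\<forall>i\<in>{1..k}. ((\<lambda>s. ln (r i s)) has_real_derivative (1 / C) * l2_inner \<Omega> (exact_b i t) v)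
      (at t within {0..T})"
    using solution_at[OF t] by (elim exE conjE)
  with i have deriv:
    "((\<lambda>s. ln (r i s)) has_real_derivative (1 / C) * l2_inner \<Omega> (exact_b i t) v) (at t within {0..T})"
    by blast
  have G_meas: "G (\<mu> t) \<in> borel_measurable (lebesgue_on \<Omega>)"
    using G_mu_l2[OF t] by (rule l2_space_measurable)
  have "exact_b i t \<in> borel_measurable (lebesgue_on \<Omega>)"
    unfolding exact_b[OF t i]
    by (rule smooth_fun_measurable(2)[OF smooth[OF i] l2_space_measurable[OF phi_l2[OF t]]])
  moreover have "v \<in> borel_measurable (lebesgue_on \<Omega>)"
    using eq by (intro borel_measurable_lebesgue_on_AE[OF spatial_domain_lebesgue[OF dom] G_meas]) auto
  ultimately have "l2_inner \<Omega> (exact_b i t) (v) = l2_inner \<Omega> (exact_b i t) (G (\<mu> t))"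
    using G_meas eq by (rule l2_inner_cong_AE)
  with deriv show ?thesis by simp
qed

text \<open>
  The perturbation estimate along the solution.  The same estimate serves both schemes: explicit data
  one step old deviate by \<open>O(h)\<close>, data extrapolated to the midpoint by \<open>O(h\<^sup>2)\<close>.
\<close>

lemma nonlinear_terms_bound:
  "\<exists>B\<ge>0. \<forall>t\<in>{0..T}. \<forall>\<eta>\<in>l2_space \<Omega>. \<forall>\<rho> e. 0 \<le> e \<longrightarrow> e \<le> E \<longrightarrow>
    (AE x in lebesgue_on \<Omega>. \<bar>\<eta> x - \<phi> t x\<bar> \<le> e) \<longrightarrow> (\<forall>i\<in>{1..k}. \<bar>\<rho> i - r i t\<bar> \<le> e) \<longrightarrow>
    (\<forall>i\<in>{1..k}. AE x in lebesgue_on \<Omega>. \<bar>sav_b \<Omega> C (F i) (\<rho> i) \<eta> x - exact_b i t x\<bar> \<le> B * e)"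
proof -
  obtain M where "AE x in lebesgue_on \<Omega>. bounded_derivs (Suc p) T M (\<lambda>t. \<phi> t x)"
    by (rule phi_regular)
  then have M: "AE x in lebesgue_on \<Omega>. \<bar>\<phi> t x\<bar> \<le> M" if "t \<in> {0..T}" for t
    by eventually_elim (rule bounded_derivs_bound[OF _ that])
  define P where "P i B \<longleftrightarrow> (\<forall>t\<in>{0..T}. \<forall>\<eta>\<in>l2_space \<Omega>. \<forall>\<rho> e. 0 \<le> e \<longrightarrow> e \<le> E \<longrightarrow>
      (AE x in lebesgue_on \<Omega>. \<bar>\<eta> x - \<phi> t x\<bar> \<le> e) \<longrightarrow> \<bar>\<rho> - r i t\<bar> \<le> e \<longrightarrow>
      (AE x in lebesgue_on \<Omega>. \<bar>sav_b \<Omega> C (F i) \<rho> \<eta> x - exact_b i t x\<bar> \<le> B * e))" for i B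
  have "\<exists>B. P i B" if i: "i \<in> {1..k}" for i
  proof -
    obtain B where B: "\<forall>u\<in>l2_space \<Omega>. \<forall>\<eta>\<in>l2_space \<Omega>. \<forall>\<rho> e. 0 \<le> e \<longrightarrow> e \<le> E \<longrightarrow>
      (AE x in lebesgue_on \<Omega>. \<bar>u x\<bar> \<le> M) \<longrightarrow> (AE x in lebesgue_on \<Omega>. \<bar>\<eta> x - u x\<bar> \<le> e) \<longrightarrow>
      \<bar>\<rho> - exp ((1 / C) * (LINT x|lebesgue_on \<Omega>. F i (u x)))\<bar> \<le> e \<longrightarrow>
      (AE x in lebesgue_on \<Omega>. \<bar>sav_b \<Omega> C (F i) \<rho> \<eta> x - deriv (F i) (u x)\<bar> \<le> B * e)"
      using sav_b_perturb[OF dom C smooth[OF i], of E M] by (elim exE conjE)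
    have "P i B"
      unfolding P_def
    proof (intro ballI allI impI)
      fix t \<eta> \<rho> e
      assume t: "t \<in> {0..T}" and *: "\<eta> \<in> l2_space \<Omega>" "0 \<le> e" "e \<le> E"
        "AE x in lebesgue_on \<Omega>. \<bar>\<eta> x - \<phi> t x\<bar> \<le> e" "\<bar>\<rho> - r i t\<bar> \<le> e"
      show "AE x in lebesgue_on \<Omega>. \<bar>sav_b \<Omega> C (F i) \<rho> \<eta> x - exact_b i t x\<bar> \<le> B * e"
        unfolding exact_b[OF t i]
        by (rule B[rule_format, OF phi_l2[OF t] *(1-3) M[OF t] *(4) *(5)[unfolded r_eq[OF t i]]])
    qed
    then show ?thesis ..
  qed
  moreover have "P i B'" if P: "P i B" and le: "B \<le> B'" for i B B'
    unfolding P_def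
  proof (intro ballI allI impI)
    fix t \<eta> \<rho> e
    assume *: "t \<in> {0..T}" "\<eta> \<in> l2_space \<Omega>" "0 \<le> e" "e \<le> E"
      "AE x in lebesgue_on \<Omega>. \<bar>\<eta> x - \<phi> t x\<bar> \<le> e" "\<bar>\<rho> - r i t\<bar> \<le> e"
    have "B * e \<le> B' * e"
      using le *(3) by (rule mult_right_mono)
    with P[unfolded P_def, rule_format, OF *]
    show "AE x in lebesgue_on \<Omega>. \<bar>sav_b \<Omega> C (F i) \<rho> \<eta> x - exact_b i t x\<bar> \<le> B' * e"
      by (auto elim: eventually_mono)
  qed
  ultimately have "\<exists>B\<ge>0. \<forall>i\<in>{1..k}. P i B"
    by (intro uniform_bound finite_atLeastAtMost)
  then obtain B where B0: "B \<ge> 0" and B: "\<forall>i\<in>{1..k}. P i B"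
    by (elim exE conjE)
  show ?thesis
  proof (intro exI[of _ B] conjI B0 ballI allI impI)
    fix t \<eta> \<rho> e i
    assume *: "t \<in> {0..T}" "\<eta> \<in> l2_space \<Omega>" "0 \<le> e" "e \<le> E"
      "AE x in lebesgue_on \<Omega>. \<bar>\<eta> x - \<phi> t x\<bar> \<le> e" "\<forall>i\<in>{1..k}. \<bar>\<rho> i - r i t\<bar> \<le> e"
      and i: "i \<in> {1..k}"
    show "AE x in lebesgue_on \<Omega>. \<bar>sav_b \<Omega> C (F i) (\<rho> i) \<eta> x - exact_b i t x\<bar> \<le> B * e"
      by (rule B[rule_format, OF i, unfolded P_def, rule_format, OF *(1-5) *(6)[rule_format, OF i]])
  qed
qed

text \<open>
  The exact solution satisfies the equation for \<open>\<mu>\<close> at time \<open>t\<close>, so the residual consists of the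
  errors made in \<open>L\<close> and in the nonlinear terms.
\<close>

lemma mu_residual_bound:
  "\<exists>B\<ge>0. \<forall>t\<in>{0..T}. \<forall>\<eta>\<in>l2_space \<Omega>. \<forall>\<rho> \<psi> e. 0 \<le> e \<longrightarrow> e \<le> E \<longrightarrow>
    (AE x in lebesgue_on \<Omega>. \<bar>\<eta> x - \<phi> t x\<bar> \<le> e) \<longrightarrow> (\<forall>i\<in>{1..k}. \<bar>\<rho> i - r i t\<bar> \<le> e) \<longrightarrow>
    (AE x in lebesgue_on \<Omega>. \<bar>L \<psi> x - L (\<phi> t) x\<bar> \<le> e) \<longrightarrow>
    (AE x in lebesgue_on \<Omega>. \<bar>mu_residual \<Omega> L C k F \<rho> \<eta> \<psi> (\<mu> t) x\<bar> \<le> B * e)"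
proof -
  obtain B where B0: "B \<ge> 0" and B: "\<forall>t\<in>{0..T}. \<forall>\<eta>\<in>l2_space \<Omega>. \<forall>\<rho> e. 0 \<le> e \<longrightarrow> e \<le> E \<longrightarrow>
      (AE x in lebesgue_on \<Omega>. \<bar>\<eta> x - \<phi> t x\<bar> \<le> e) \<longrightarrow> (\<forall>i\<in>{1..k}. \<bar>\<rho> i - r i t\<bar> \<le> e) \<longrightarrow>
      (\<forall>i\<in>{1..k}. AE x in lebesgue_on \<Omega>. \<bar>sav_b \<Omega> C (F i) (\<rho> i) \<eta> x - exact_b i t x\<bar> \<le> B * e)"
    using nonlinear_terms_bound[of E] by (elim exE conjE)
  show ?thesis
  proof (intro exI[of _ "1 + real k * B"] conjI ballI allI impI)
    show "0 \<le> 1 + real k * B"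
      using B0 by simp
  next
    fix t \<eta> \<rho> \<psi> e
    assume t: "t \<in> {0..T}" and *: "\<eta> \<in> l2_space \<Omega>" "0 \<le> e" "e \<le> E"
      "AE x in lebesgue_on \<Omega>. \<bar>\<eta> x - \<phi> t x\<bar> \<le> e" "\<forall>i\<in>{1..k}. \<bar>\<rho> i - r i t\<bar> \<le> e"
      and lin: "AE x in lebesgue_on \<Omega>. \<bar>L \<psi> x - L (\<phi> t) x\<bar> \<le> e"
    let ?b = "\<lambda>i. sav_b \<Omega> C (F i) (\<rho> i) \<eta>"
    have "AE x in lebesgue_on \<Omega>. \<bar>?b i x - exact_b i t x\<bar> \<le> B * e" if "i \<in> {1..k}" for i
      by (rule B[rule_format, OF t *(1-4) _ that]) (use *(5) in blast)
    then have "AE x in lebesgue_on \<Omega>. \<forall>i\<in>{1..k}. \<bar>?b i x - exact_b i t x\<bar> \<le> B * e"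
      by (intro AE_finite_allI) auto
    with mu_eq[OF t] lin
    show "AE x in lebesgue_on \<Omega>. \<bar>mu_residual \<Omega> L C k F \<rho> \<eta> \<psi> (\<mu> t) x\<bar> \<le> (1 + real k * B) * e"
    proof eventually_elim
      case (elim x)
      have "\<bar>\<Sum>i=1..k. ?b i x - exact_b i t x\<bar> \<le> (\<Sum>i=1..k. B * e)"
        by (rule order_trans[OF sum_abs sum_mono]) (use elim(3) in blast)
      then have "\<bar>\<Sum>i=1..k. ?b i x - exact_b i t x\<bar> \<le> real k * (B * e)"
        by simp
      moreover have "mu_residual \<Omega> L C k F \<rho> \<eta> \<psi> (\<mu> t) x
          = - (L \<psi> x - L (\<phi> t) x) - (\<Sum>i=1..k. ?b i x - exact_b i t x)"
        using elim(1) by (simp add: mu_residual_def sum_subtractf)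
      ultimately have "\<bar>mu_residual \<Omega> L C k F \<rho> \<eta> \<psi> (\<mu> t) x\<bar> \<le> e + real k * (B * e)"
        using elim(2) by linarith
      then show ?case
        by (simp add: algebra_simps)
    qed
  qed
qed

text \<open>
  At a reference time \<open>t\<close> the logarithm of \<open>r\<close> has derivative \<open>(b, G \<mu>) / C\<close>.  The residual compares
  difference quotients over \<open>[s, s + h]\<close> and perturbed nonlinear terms with the exact quantities in
  this relation.  The first-order scheme is centred at \<open>t = s\<close>, the Crank--Nicolson scheme at
  \<open>t = s + h / 2\<close>.
\<close>

lemma r_residual_bound:
  "\<exists>B\<ge>0. \<forall>t\<in>{0..T}. \<forall>s\<in>{0..T}. \<forall>h>0. s + h \<le> T \<longrightarrow> (\<forall>\<eta>\<in>l2_space \<Omega>. \<forall>\<rho> e. 0 \<le> e \<longrightarrow> e \<le> E \<longrightarrow>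
    (AE x in lebesgue_on \<Omega>. \<bar>\<eta> x - \<phi> t x\<bar> \<le> e) \<longrightarrow> (\<forall>i\<in>{1..k}. \<bar>\<rho> i - r i t\<bar> \<le> e) \<longrightarrow>
    (AE x in lebesgue_on \<Omega>. \<bar>(\<phi> (s + h) x - \<phi> s x) / h - G (\<mu> t) x\<bar> \<le> e) \<longrightarrow>
    (\<forall>i\<in>{1..k}. \<bar>(ln (r i (s + h)) - ln (r i s)) / h
        - (1 / C) * l2_inner \<Omega> (exact_b i t) (G (\<mu> t))\<bar> \<le> e) \<longrightarrow>
    (\<forall>i\<in>{1..k}. \<bar>r_residual \<Omega> C (F i) h (\<rho> i) \<eta> (\<phi> s) (\<phi> (s + h)) (r i s) (r i (s + h))\<bar> \<le> B * e))"
proof -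
  let ?M = "lebesgue_on \<Omega>"
  obtain B where B0: "B \<ge> 0" and B: "\<forall>t\<in>{0..T}. \<forall>\<eta>\<in>l2_space \<Omega>. \<forall>\<rho> e. 0 \<le> e \<longrightarrow> e \<le> E \<longrightarrow>
      (AE x in ?M. \<bar>\<eta> x - \<phi> t x\<bar> \<le> e) \<longrightarrow> (\<forall>i\<in>{1..k}. \<bar>\<rho> i - r i t\<bar> \<le> e) \<longrightarrow>
      (\<forall>i\<in>{1..k}. AE x in ?M. \<bar>sav_b \<Omega> C (F i) (\<rho> i) \<eta> x - exact_b i t x\<bar> \<le> B * e)"
    using nonlinear_terms_bound[of E] by (elim exE conjE)
  obtain M where M0: "M \<ge> 0" and M: "AE x in ?M. bounded_derivs (Suc p) T M (\<lambda>t. \<phi> t x)"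
    by (rule phi_regular)
  have \<phi>M: "AE x in ?M. \<bar>\<phi> t x\<bar> \<le> M" if "t \<in> {0..T}" for t
    using M by eventually_elim (rule bounded_derivs_bound[OF _ that])
  have "\<exists>A. \<forall>y. \<bar>y\<bar> \<le> M \<longrightarrow> \<bar>deriv (F i) y\<bar> \<le> A" if "i \<in> {1..k}" for i
    using smooth_fun_bounds[OF smooth[OF that], of M] by blast
  then have "\<exists>A\<ge>0. \<forall>i\<in>{1..k}. \<forall>y. \<bar>y\<bar> \<le> M \<longrightarrow> \<bar>deriv (F i) y\<bar> \<le> A"
    by (rule uniform_bound[OF finite_atLeastAtMost]) (blast intro: order_trans)+
  then obtain A where A0: "A \<ge> 0"
    and A: "\<And>i y. i \<in> {1..k} \<Longrightarrow> \<bar>y\<bar> \<le> M \<Longrightarrow> \<bar>deriv (F i) y\<bar> \<le> A"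
    by blast
  show ?thesis
  proof (intro exI[of _ "1 + V * (B * M + A) / C"] conjI ballI allI impI)
    show "0 \<le> 1 + V * (B * M + A) / C"
      using B0 M0 A0 C by simp
  next
    fix t s h \<eta> \<rho> e i
    assume t: "t \<in> {0..T}" and s: "s \<in> {0..T}" and h: "0 < h" "s + h \<le> T"
      and near: "\<eta> \<in> l2_space \<Omega>" "0 \<le> e" "e \<le> E" "AE x in ?M. \<bar>\<eta> x - \<phi> t x\<bar> \<le> e"
        "\<forall>i\<in>{1..k}. \<bar>\<rho> i - r i t\<bar> \<le> e"
      and dq: "AE x in ?M. \<bar>(\<phi> (s + h) x - \<phi> s x) / h - G (\<mu> t) x\<bar> \<le> e"
      and r_dq: "\<forall>i\<in>{1..k}. \<bar>(ln (r i (s + h)) - ln (r i s)) / h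
        - (1 / C) * l2_inner \<Omega> (exact_b i t) (G (\<mu> t))\<bar> \<le> e"
      and i: "i \<in> {1..k}"
    let ?b = "sav_b \<Omega> C (F i) (\<rho> i) \<eta>" and ?d = "\<lambda>x. (\<phi> (s + h) x - \<phi> s x) / h"
    have sh: "s + h \<in> {0..T}"
      using s h by simp
    have bdiff: "AE x in ?M. \<bar>?b x - exact_b i t x\<bar> \<le> B * e"
      by (rule B[rule_format, OF t near(1-4) _ i]) (use near(5) in blast)
    have bA: "AE x in ?M. \<bar>exact_b i t x\<bar> \<le> A"
      unfolding exact_b[OF t i] using \<phi>M[OF t] by eventually_elim (use A i in blast)
    have b_l2: "exact_b i t \<in> l2_space \<Omega>"
      by (rule exact_b_l2[OF t i \<phi>M[OF t]])
    have "AE x in ?M. \<bar>?b x\<bar> \<le> A + B * e"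
      using bdiff bA by eventually_elim linarith
    then have b'_l2: "?b \<in> l2_space \<Omega>"
    proof (rule bounded_l2_space[OF fin, rotated])
      show "?b \<in> borel_measurable ?M"
        unfolding sav_b_def using smooth_fun_measurable(2)[OF smooth[OF i] l2_space_measurable[OF near(1)]]
        by (intro borel_measurable_times borel_measurable_const)
    qed
    have d_l2: "?d \<in> l2_space \<Omega>"
      using l2_space_cmult[OF l2_space_diff[OF phi_l2[OF sh] phi_l2[OF s]], of "1 / h"] by simp
    have dM: "AE x in ?M. \<bar>?d x\<bar> \<le> M"
      using M
    proof eventually_elim
      case (elim x)
      then have "bounded_derivs 1 T M (\<lambda>t. \<phi> t x)"
        by (rule bounded_derivs_mono) auto
      from bounded_derivs_lipschitz[OF this s sh] show ?case
        using h by (simp add: abs_divide divide_le_eq)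
    qed
    have "\<bar>l2_inner \<Omega> ?b ?d - l2_inner \<Omega> (exact_b i t) (G (\<mu> t))\<bar> \<le> V * ((B * e) * M + A * e)"
      by (rule l2_inner_perturb[OF fin b_l2 b'_l2 G_mu_l2[OF t] d_l2 bA dM bdiff dq])
    then have "(1 / C) * \<bar>l2_inner \<Omega> ?b ?d - l2_inner \<Omega> (exact_b i t) (G (\<mu> t))\<bar>
        \<le> (1 / C) * (V * ((B * e) * M + A * e))"
      using C by (intro mult_left_mono) auto
    moreover have "\<bar>(1 / C) * l2_inner \<Omega> ?b ?d - (1 / C) * l2_inner \<Omega> (exact_b i t) (G (\<mu> t))\<bar>
        = (1 / C) * \<bar>l2_inner \<Omega> ?b ?d - l2_inner \<Omega> (exact_b i t) (G (\<mu> t))\<bar>"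
      using C by (simp add: abs_divide flip: diff_divide_distrib)
    moreover have "\<bar>(ln (r i (s + h)) - ln (r i s)) / h
        - (1 / C) * l2_inner \<Omega> (exact_b i t) (G (\<mu> t))\<bar> \<le> e"
      using r_dq i by blast
    ultimately have "\<bar>r_residual \<Omega> C (F i) h (\<rho> i) \<eta> (\<phi> s) (\<phi> (s + h)) (r i s) (r i (s + h))\<bar>
        \<le> e + (1 / C) * (V * ((B * e) * M + A * e))"
      unfolding r_residual_def by linarith
    also have "\<dots> = (1 + V * (B * M + A) / C) * e"
      using C by (simp add: field_simps)
    finally show "\<bar>r_residual \<Omega> C (F i) h (\<rho> i) \<eta> (\<phi> s) (\<phi> (s + h)) (r i s) (r i (s + h))\<bar>
        \<le> (1 + V * (B * M + A) / C) * e" .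
  qed
qed

lemma L_regular:
  obtains M where "0 \<le> M" "AE x in lebesgue_on \<Omega>. bounded_derivs p T M (\<lambda>t. L (\<phi> t) x)"
proof -
  obtain K where "AE x in lebesgue_on \<Omega>. bounded_derivs p T K (\<lambda>t. L (\<phi> t) x)"
    using reg unfolding sufficiently_regular_def time_regular_def by (elim exE conjE)
  then have "AE x in lebesgue_on \<Omega>. bounded_derivs p T \<bar>K\<bar> (\<lambda>t. L (\<phi> t) x)"
    by eventually_elim (erule bounded_derivs_mono, auto)
  then show thesis by (intro that[of "\<bar>K\<bar>"]) auto
qed

text \<open>
  Each difference quotient is compared with the derivative at the end point where its right-hand
  side is evaluated: the right one for \<open>\<phi>\<close>, the left one for \<open>ln r\<close>, whose nonlinear term is taken there.  In
  the equation for \<open>\<mu>\<close> at the right end point the nonlinear terms are one step old.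
\<close>

lemma first_order_residuals:
  "\<exists>K. \<forall>s h. 0 \<le> s \<longrightarrow> 0 < h \<longrightarrow> s + h \<le> T \<longrightarrow>
    (AE x in lebesgue_on \<Omega>. \<bar>phi_residual G h (\<phi> s) (\<phi> (s + h)) (\<mu> (s + h)) x\<bar> \<le> K * h) \<and>
    (AE x in lebesgue_on \<Omega>.
      \<bar>mu_residual \<Omega> L C k F (\<lambda>i. r i s) (\<phi> s) (\<phi> (s + h)) (\<mu> (s + h)) x\<bar> \<le> K * h) \<and>
    (\<forall>i\<in>{1..k}. \<bar>r_residual \<Omega> C (F i) h (r i s) (\<phi> s) (\<phi> s) (\<phi> (s + h)) (r i s) (r i (s + h))\<bar>
      \<le> K * h)"
proof -
  let ?M = "lebesgue_on \<Omega>"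
  obtain M where M0: "0 \<le> M" and M: "AE x in ?M. bounded_derivs (Suc p) T M (\<lambda>t. \<phi> t x)"
    by (rule phi_regular)
  obtain R where R0: "0 \<le> R" and R: "\<And>i. i \<in> {1..k} \<Longrightarrow> bounded_derivs (Suc p) T R (r i)"
    and lnR: "\<And>i. i \<in> {1..k} \<Longrightarrow> bounded_derivs (Suc p) T R (\<lambda>t. ln (r i t))"
    by (rule r_regular) (rule that, assumption+)
  define D where "D = M + R"
  have D: "0 \<le> D" "M \<le> D" "R \<le> D"
    using M0 R0 by (auto simp: D_def)
  obtain A where A0: "A \<ge> 0" and A: "\<forall>t\<in>{0..T}. \<forall>\<eta>\<in>l2_space \<Omega>. \<forall>\<rho> \<psi> e. 0 \<le> e \<longrightarrow> e \<le> D * T \<longrightarrow>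
    (AE x in ?M. \<bar>\<eta> x - \<phi> t x\<bar> \<le> e) \<longrightarrow> (\<forall>i\<in>{1..k}. \<bar>\<rho> i - r i t\<bar> \<le> e) \<longrightarrow>
    (AE x in ?M. \<bar>L \<psi> x - L (\<phi> t) x\<bar> \<le> e) \<longrightarrow>
    (AE x in ?M. \<bar>mu_residual \<Omega> L C k F \<rho> \<eta> \<psi> (\<mu> t) x\<bar> \<le> A * e)"
    using mu_residual_bound[of "D * T"] by (elim exE conjE)
  obtain B where B0: "B \<ge> 0" and B: "\<forall>t\<in>{0..T}. \<forall>s\<in>{0..T}. \<forall>h>0. s + h \<le> T \<longrightarrow>
    (\<forall>\<eta>\<in>l2_space \<Omega>. \<forall>\<rho> e. 0 \<le> e \<longrightarrow> e \<le> D * T \<longrightarrow>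
    (AE x in ?M. \<bar>\<eta> x - \<phi> t x\<bar> \<le> e) \<longrightarrow> (\<forall>i\<in>{1..k}. \<bar>\<rho> i - r i t\<bar> \<le> e) \<longrightarrow>
    (AE x in ?M. \<bar>(\<phi> (s + h) x - \<phi> s x) / h - G (\<mu> t) x\<bar> \<le> e) \<longrightarrow>
    (\<forall>i\<in>{1..k}. \<bar>(ln (r i (s + h)) - ln (r i s)) / h
        - (1 / C) * l2_inner \<Omega> (exact_b i t) (G (\<mu> t))\<bar> \<le> e) \<longrightarrow>
    (\<forall>i\<in>{1..k}. \<bar>r_residual \<Omega> C (F i) h (\<rho> i) \<eta> (\<phi> s) (\<phi> (s + h)) (r i s) (r i (s + h))\<bar> \<le> B * e))"
    using r_residual_bound[of "D * T"] by (elim exE conjE)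
  \<comment> \<open>All perturbations in one step are at most \<open>D\<close> times a power of \<open>h\<close>; the residuals are bounded by
    these perturbations and their multiples by \<open>A\<close> and \<open>B\<close>.\<close>
  define K where "K = (1 + A + B) * D"
  have K: "D \<le> K" "A * D \<le> K" "B * D \<le> K"
    using D A0 B0 by (auto simp: K_def algebra_simps)
  show ?thesis
  proof (intro exI[of _ K] allI impI)
    fix s h assume s: "0 \<le> s" and h: "0 < h" and sh: "s + h \<le> T"
    have st: "s \<in> {0..T}" "s + h \<in> {0..T}"
      using s h sh by auto
    have le: "M * h \<le> D * h" "R * h \<le> D * h" "D * h \<le> K * h" "A * (D * h) \<le> K * h" "B * (D * h) \<le> K * h"
      using D K h by (simp_all add: mult_right_mono flip: mult.assoc)
    have e: "0 \<le> D * h" "D * h \<le> D * T"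
      using D h s sh by (auto intro: mult_left_mono)
    have quotient: "AE x in ?M. \<bar>(\<phi> (s + h) x - \<phi> s x) / h - G (\<mu> t) x\<bar> \<le> D * h"
      if t: "t = s \<or> t = s + h" for t
    proof -
      have "t \<in> {0..T}" using t st by auto
      from phi_derivative[OF this] M show ?thesis
      proof eventually_elim
        case (elim x)
        have "bounded_derivs 2 T M (\<lambda>t. \<phi> t x)"
          using elim(2) by (rule bounded_derivs_mono) (use p in auto)
        from difference_quotient_endpoint[OF this T h st t elim(1)] le(1) show ?case
          by linarith
      qed
    qed
    have phi: "AE x in ?M. \<bar>phi_residual G h (\<phi> s) (\<phi> (s + h)) (\<mu> (s + h)) x\<bar> \<le> K * h"
      using quotient[of "s + h"] le(3) unfolding phi_residual_def by (auto elim!: eventually_mono)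
    have step: "\<bar>s - (s + h)\<bar> = h"
      using h by simp
    have "AE x in ?M. \<bar>\<phi> s x - \<phi> (s + h) x\<bar> \<le> D * h"
      using M
    proof eventually_elim
      case (elim x)
      then have "bounded_derivs 1 T M (\<lambda>t. \<phi> t x)"
        by (rule bounded_derivs_mono) auto
      from bounded_derivs_lipschitz[OF this st(2,1)] le(1) show ?case
        unfolding step by linarith
    qed
    moreover have "\<forall>i\<in>{1..k}. \<bar>r i s - r i (s + h)\<bar> \<le> D * h"
    proof
      fix i assume "i \<in> {1..k}"
      then have "bounded_derivs 1 T R (r i)"
        using R by (intro bounded_derivs_mono[OF R]) auto
      from bounded_derivs_lipschitz[OF this st(2,1)] le(2) show "\<bar>r i s - r i (s + h)\<bar> \<le> D * h"
        unfolding step by linarith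
    qed
    moreover have "AE x in ?M. \<bar>L (\<phi> (s + h)) x - L (\<phi> (s + h)) x\<bar> \<le> D * h"
      using e by simp
    ultimately have "AE x in ?M.
        \<bar>mu_residual \<Omega> L C k F (\<lambda>i. r i s) (\<phi> s) (\<phi> (s + h)) (\<mu> (s + h)) x\<bar> \<le> A * (D * h)"
      by (intro A[rule_format, OF st(2) phi_l2[OF st(1)] e]) (assumption | erule (1) bspec)+
    then have mu: "AE x in ?M.
        \<bar>mu_residual \<Omega> L C k F (\<lambda>i. r i s) (\<phi> s) (\<phi> (s + h)) (\<mu> (s + h)) x\<bar> \<le> K * h"
      using le(4) by (auto elim!: eventually_mono)
    have quotient_ln: "\<bar>(ln (r i (s + h)) - ln (r i s)) / h
        - (1 / C) * l2_inner \<Omega> (exact_b i s) (G (\<mu> s))\<bar> \<le> D * h" if i: "i \<in> {1..k}" for i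
    proof -
      have "bounded_derivs 2 T R (\<lambda>t. ln (r i t))"
        using lnR[OF i] by (rule bounded_derivs_mono) (use p in auto)
      from difference_quotient_endpoint[OF this T h st _ ln_r_derivative[OF st(1) i]] le(2)
      show ?thesis by linarith
    qed
    have "\<bar>r_residual \<Omega> C (F i) h (r i s) (\<phi> s) (\<phi> s) (\<phi> (s + h)) (r i s) (r i (s + h))\<bar> \<le> K * h"
      if i: "i \<in> {1..k}" for i
    proof -
      have "\<bar>r_residual \<Omega> C (F i) h (r i s) (\<phi> s) (\<phi> s) (\<phi> (s + h)) (r i s) (r i (s + h))\<bar>
          \<le> B * (D * h)"
        by (rule B[rule_format, OF st(1) st(1) h sh phi_l2[OF st(1)] e, of "\<lambda>i. r i s"])
          (use e quotient[of s] quotient_ln i in auto)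
      with le(5) show ?thesis by linarith
    qed
    with phi mu show "(AE x in ?M. \<bar>phi_residual G h (\<phi> s) (\<phi> (s + h)) (\<mu> (s + h)) x\<bar> \<le> K * h) \<and>
      (AE x in ?M. \<bar>mu_residual \<Omega> L C k F (\<lambda>i. r i s) (\<phi> s) (\<phi> (s + h)) (\<mu> (s + h)) x\<bar> \<le> K * h) \<and>
      (\<forall>i\<in>{1..k}. \<bar>r_residual \<Omega> C (F i) h (r i s) (\<phi> s) (\<phi> s) (\<phi> (s + h)) (r i s) (r i (s + h))\<bar>
        \<le> K * h)"
      by blast
  qed
qed

text \<open>
  Every equation is compared with the exact one at the midpoint, about which difference
  quotients and averages are accurate to second order.
\<close>

lemma second_order_residuals:
  assumes p2: "p = 2"
  shows "\<exists>K. \<forall>s h. 0 \<le> s \<longrightarrow> 0 < h \<longrightarrow> s + h \<le> T \<longrightarrow> (\<forall>\<eta>\<in>l2_space \<Omega>. \<forall>\<rho>.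
    (AE x in lebesgue_on \<Omega>. \<bar>\<eta> x - \<phi> (s + h / 2) x\<bar> \<le> K\<^sub>0 * h\<^sup>2) \<longrightarrow>
    (\<forall>i\<in>{1..k}. \<bar>\<rho> i - r i (s + h / 2)\<bar> \<le> K\<^sub>0 * h\<^sup>2) \<longrightarrow>
    (AE x in lebesgue_on \<Omega>. \<bar>phi_residual G h (\<phi> s) (\<phi> (s + h)) (\<mu> (s + h / 2)) x\<bar> \<le> K * h\<^sup>2) \<and>
    (AE x in lebesgue_on \<Omega>.
      \<bar>mu_residual \<Omega> L C k F \<rho> \<eta> (midpoint_fun (\<phi> s) (\<phi> (s + h))) (\<mu> (s + h / 2)) x\<bar> \<le> K * h\<^sup>2) \<and>
    (\<forall>i\<in>{1..k}. \<bar>r_residual \<Omega> C (F i) h (\<rho> i) \<eta> (\<phi> s) (\<phi> (s + h)) (r i s) (r i (s + h))\<bar>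
      \<le> K * h\<^sup>2))"
proof -
  let ?M = "lebesgue_on \<Omega>"
  obtain M where M0: "0 \<le> M" and M: "AE x in ?M. bounded_derivs (Suc p) T M (\<lambda>t. \<phi> t x)"
    by (rule phi_regular)
  obtain R where R0: "0 \<le> R"
    and lnR: "\<And>i. i \<in> {1..k} \<Longrightarrow> bounded_derivs (Suc p) T R (\<lambda>t. ln (r i t))"
    by (rule r_regular) (rule that, assumption+)
  obtain Q where Q0: "0 \<le> Q" and Q: "AE x in ?M. bounded_derivs p T Q (\<lambda>t. L (\<phi> t) x)"
    by (rule L_regular)
  have three: "Suc p = 3"
    using p2 by simp
  define D where "D = M + R + Q + \<bar>K\<^sub>0\<bar>"
  have D: "0 \<le> D" "M \<le> D" "R \<le> D" "Q \<le> D" "K\<^sub>0 \<le> D"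
    using M0 R0 Q0 by (auto simp: D_def)
  obtain A where A0: "A \<ge> 0" and A: "\<forall>t\<in>{0..T}. \<forall>\<eta>\<in>l2_space \<Omega>. \<forall>\<rho> \<psi> e. 0 \<le> e \<longrightarrow> e \<le> D * T\<^sup>2 \<longrightarrow>
    (AE x in ?M. \<bar>\<eta> x - \<phi> t x\<bar> \<le> e) \<longrightarrow> (\<forall>i\<in>{1..k}. \<bar>\<rho> i - r i t\<bar> \<le> e) \<longrightarrow>
    (AE x in ?M. \<bar>L \<psi> x - L (\<phi> t) x\<bar> \<le> e) \<longrightarrow>
    (AE x in ?M. \<bar>mu_residual \<Omega> L C k F \<rho> \<eta> \<psi> (\<mu> t) x\<bar> \<le> A * e)"
    using mu_residual_bound[of "D * T\<^sup>2"] by (elim exE conjE)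
  obtain B where B0: "B \<ge> 0" and B: "\<forall>t\<in>{0..T}. \<forall>s\<in>{0..T}. \<forall>h>0. s + h \<le> T \<longrightarrow>
    (\<forall>\<eta>\<in>l2_space \<Omega>. \<forall>\<rho> e. 0 \<le> e \<longrightarrow> e \<le> D * T\<^sup>2 \<longrightarrow>
    (AE x in ?M. \<bar>\<eta> x - \<phi> t x\<bar> \<le> e) \<longrightarrow> (\<forall>i\<in>{1..k}. \<bar>\<rho> i - r i t\<bar> \<le> e) \<longrightarrow>
    (AE x in ?M. \<bar>(\<phi> (s + h) x - \<phi> s x) / h - G (\<mu> t) x\<bar> \<le> e) \<longrightarrow>
    (\<forall>i\<in>{1..k}. \<bar>(ln (r i (s + h)) - ln (r i s)) / h
        - (1 / C) * l2_inner \<Omega> (exact_b i t) (G (\<mu> t))\<bar> \<le> e) \<longrightarrow>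
    (\<forall>i\<in>{1..k}. \<bar>r_residual \<Omega> C (F i) h (\<rho> i) \<eta> (\<phi> s) (\<phi> (s + h)) (r i s) (r i (s + h))\<bar> \<le> B * e))"
    using r_residual_bound[of "D * T\<^sup>2"] by (elim exE conjE)
  \<comment> \<open>All perturbations in one step are at most \<open>D\<close> times a power of \<open>h\<close>; the residuals are bounded by
    these perturbations and their multiples by \<open>A\<close> and \<open>B\<close>.\<close>
  define K where "K = (1 + A + B) * D"
  have K: "D \<le> K" "A * D \<le> K" "B * D \<le> K"
    using D A0 B0 by (auto simp: K_def algebra_simps)
  show ?thesis
  proof (intro exI[of _ K] allI impI ballI)
    fix s h \<eta> \<rho>
    assume s: "0 \<le> s" and h: "0 < h" and sh: "s + h \<le> T" and \<eta>: "\<eta> \<in> l2_space \<Omega>"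
      and near: "AE x in ?M. \<bar>\<eta> x - \<phi> (s + h / 2) x\<bar> \<le> K\<^sub>0 * h\<^sup>2"
      and r_near: "\<forall>i\<in>{1..k}. \<bar>\<rho> i - r i (s + h / 2)\<bar> \<le> K\<^sub>0 * h\<^sup>2"
    let ?m = "s + h / 2"
    have st: "s \<in> {0..T}" "s + h \<in> {0..T}" "?m \<in> {0..T}"
      using s h sh by auto
    have le: "M * h\<^sup>2 \<le> D * h\<^sup>2" "R * h\<^sup>2 \<le> D * h\<^sup>2" "Q * h\<^sup>2 \<le> D * h\<^sup>2" "K\<^sub>0 * h\<^sup>2 \<le> D * h\<^sup>2"
      "D * h\<^sup>2 \<le> K * h\<^sup>2" "A * (D * h\<^sup>2) \<le> K * h\<^sup>2" "B * (D * h\<^sup>2) \<le> K * h\<^sup>2"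
      using D K by (simp_all add: mult_right_mono flip: mult.assoc)
    have "h\<^sup>2 \<le> T\<^sup>2"
      using s h sh by (intro power_mono) auto
    then have e: "0 \<le> D * h\<^sup>2" "D * h\<^sup>2 \<le> D * T\<^sup>2"
      using D by (auto intro: mult_left_mono)
    have near': "AE x in ?M. \<bar>\<eta> x - \<phi> ?m x\<bar> \<le> D * h\<^sup>2"
      using near by eventually_elim (use le(4) in linarith)
    have r_near': "\<bar>\<rho> i - r i ?m\<bar> \<le> D * h\<^sup>2" if "i \<in> {1..k}" for i
      using r_near[rule_format, OF that] le(4) by linarith
    have quotient: "AE x in ?M. \<bar>(\<phi> (s + h) x - \<phi> s x) / h - G (\<mu> ?m) x\<bar> \<le> D * h\<^sup>2"
      using phi_derivative[OF st(3)] M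
    proof eventually_elim
      case (elim x)
      from difference_quotient_midpoint[OF elim(2)[unfolded three] T h st(1,2) elim(1)] le(1)
      show ?case by linarith
    qed
    then have phi: "AE x in ?M. \<bar>phi_residual G h (\<phi> s) (\<phi> (s + h)) (\<mu> ?m) x\<bar> \<le> K * h\<^sup>2"
      using le(5) unfolding phi_residual_def by (auto elim!: eventually_mono)
    have ends: "?m + h / 2 = s + h" "?m - h / 2 = s"
      by simp_all
    have "AE x in ?M. \<bar>L (midpoint_fun (\<phi> s) (\<phi> (s + h))) x - L (\<phi> ?m) x\<bar> \<le> D * h\<^sup>2"
      using linear_operator_midpoint(2)[OF L phi_dom[OF st(1)] phi_dom[OF st(2)]] Q
    proof eventually_elim
      case (elim x)
      have "\<bar>(L (\<phi> (?m + h / 2)) x + L (\<phi> (?m - h / 2)) x) / 2 - L (\<phi> ?m) x\<bar> \<le> Q * (h / 2)\<^sup>2"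
        by (rule midpoint_average[OF elim(2)[unfolded p2] T st(3)]) (use st in auto)
      also have "\<dots> \<le> Q * h\<^sup>2"
        using Q0 h by (simp add: power_divide)
      also note le(3)
      finally show ?case
        unfolding elim(1) by (simp only: ends)
    qed
    with near' have "AE x in ?M. \<bar>mu_residual \<Omega> L C k F \<rho> \<eta> (midpoint_fun (\<phi> s) (\<phi> (s + h))) (\<mu> ?m) x\<bar>
        \<le> A * (D * h\<^sup>2)"
      using r_near' by (intro A[rule_format, OF st(3) \<eta> e])
    then have mu: "AE x in ?M. \<bar>mu_residual \<Omega> L C k F \<rho> \<eta> (midpoint_fun (\<phi> s) (\<phi> (s + h))) (\<mu> ?m) x\<bar>
        \<le> K * h\<^sup>2"
      using le(6) by (auto elim!: eventually_mono)
    have quotient_ln: "\<bar>(ln (r i (s + h)) - ln (r i s)) / h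
        - (1 / C) * l2_inner \<Omega> (exact_b i ?m) (G (\<mu> ?m))\<bar> \<le> D * h\<^sup>2" if i: "i \<in> {1..k}" for i
      using difference_quotient_midpoint[OF lnR[OF i, unfolded three] T h st(1,2) ln_r_derivative[OF st(3) i]] le(2)
      by linarith
    have "\<bar>r_residual \<Omega> C (F i) h (\<rho> i) \<eta> (\<phi> s) (\<phi> (s + h)) (r i s) (r i (s + h))\<bar> \<le> K * h\<^sup>2"
      if i: "i \<in> {1..k}" for i
    proof -
      have "\<bar>r_residual \<Omega> C (F i) h (\<rho> i) \<eta> (\<phi> s) (\<phi> (s + h)) (r i s) (r i (s + h))\<bar> \<le> B * (D * h\<^sup>2)"
        using r_near' quotient_ln
        by (intro B[rule_format, OF st(3) st(1) h sh \<eta> e near' _ quotient _ i])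
      with le(7) show ?thesis by linarith
    qed
    with phi mu show "(AE x in ?M. \<bar>phi_residual G h (\<phi> s) (\<phi> (s + h)) (\<mu> ?m) x\<bar> \<le> K * h\<^sup>2) \<and>
      (AE x in ?M. \<bar>mu_residual \<Omega> L C k F \<rho> \<eta> (midpoint_fun (\<phi> s) (\<phi> (s + h))) (\<mu> ?m) x\<bar> \<le> K * h\<^sup>2) \<and>
      (\<forall>i\<in>{1..k}. \<bar>r_residual \<Omega> C (F i) h (\<rho> i) \<eta> (\<phi> s) (\<phi> (s + h)) (r i s) (r i (s + h))\<bar> \<le> K * h\<^sup>2)"
      by blast
  qed
qed

lemma extrapolation_second_order:
  "\<exists>K. \<forall>s h. 0 < h \<longrightarrow> h \<le> s \<longrightarrow> s + h / 2 \<le> T \<longrightarrow>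
    (AE x in lebesgue_on \<Omega>. \<bar>3 / 2 * \<phi> s x - 1 / 2 * \<phi> (s - h) x - \<phi> (s + h / 2) x\<bar> \<le> K * h\<^sup>2) \<and>
    (\<forall>i\<in>{1..k}. \<bar>3 / 2 * r i s - 1 / 2 * r i (s - h) - r i (s + h / 2)\<bar> \<le> K * h\<^sup>2)"
proof -
  let ?M = "lebesgue_on \<Omega>"
  obtain M where M0: "0 \<le> M" and M: "AE x in ?M. bounded_derivs (Suc p) T M (\<lambda>t. \<phi> t x)"
    by (rule phi_regular)
  obtain R where R0: "0 \<le> R" and R: "\<And>i. i \<in> {1..k} \<Longrightarrow> bounded_derivs (Suc p) T R (r i)"
    by (rule r_regular) (rule that, assumption+)
  show ?thesis
  proof (intro exI[of _ "M + R"] allI impI conjI ballI)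
    fix s h assume h: "0 < h" and hs: "h \<le> s" "s + h / 2 \<le> T"
    have st: "s \<in> {0..T}" "s - h \<in> {0..T}" "s + h / 2 \<in> {0..T}"
      using h hs by auto
    show "AE x in ?M. \<bar>3 / 2 * \<phi> s x - 1 / 2 * \<phi> (s - h) x - \<phi> (s + h / 2) x\<bar> \<le> (M + R) * h\<^sup>2"
      using M
    proof eventually_elim
      case (elim x)
      then have "bounded_derivs 2 T (M + R) (\<lambda>t. \<phi> t x)"
        by (rule bounded_derivs_mono) (use p R0 in auto)
      from linear_extrapolation[OF this T st] show ?case .
    qed
    fix i assume "i \<in> {1..k}"
    then have "bounded_derivs 2 T (M + R) (r i)"
      by (intro bounded_derivs_mono[OF R]) (use p M0 in auto)
    from linear_extrapolation[OF this T st]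
    show "\<bar>3 / 2 * r i s - 1 / 2 * r i (s - h) - r i (s + h / 2)\<bar> \<le> (M + R) * h\<^sup>2" .
  qed
qed

end

section \<open>Linearity, accuracy and stability of the schemes\<close>

lemma time_grid:
  assumes "T > 0" "N \<ge> 1" "n < N" "dt = T / real N"
  shows "0 < dt" "0 \<le> real n * dt" "real n * dt + dt \<le> T" "real n * dt + dt / 2 \<le> T"
    and "(real n + 1) * dt = real n * dt + dt" "(real n + 1 / 2) * dt = real n * dt + dt / 2"
    and "(real n - 1) * dt = real n * dt - dt"
proof -
  show "0 < dt" "0 \<le> real n * dt"
    using assms by simp_all
  have "(real n + 1) * dt \<le> real N * dt"
    using assms by (intro mult_right_mono) auto
  also have "\<dots> = T"
    using assms by simp
  finally show "real n * dt + dt \<le> T"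
    by (simp only: distrib_right mult_1_left)
  with \<open>0 < dt\<close> show "real n * dt + dt / 2 \<le> T"
    by linarith
qed (simp_all add: algebra_simps)

theorem theorem5p1:
  fixes \<Omega> :: "'a::euclidean_space set"
    and D\<^sub>L D\<^sub>G :: "('a \<Rightarrow> real) set"
    and L G :: "('a \<Rightarrow> real) \<Rightarrow> 'a \<Rightarrow> real"
    and C :: real and k :: nat and F :: "nat \<Rightarrow> real \<Rightarrow> real"
  assumes "spatial_domain \<Omega>"
    and "linear_operator \<Omega> D\<^sub>L L" and "symmetric_nonneg \<Omega> D\<^sub>L L"
    and "linear_operator \<Omega> D\<^sub>G G" and "nonpositive \<Omega> D\<^sub>G G"
    and "k \<ge> 1" and "C > 0"
    and "\<And>i. i \<in> {1..k} \<Longrightarrow> smooth_fun (F i)"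
  shows "
    \<comment> \<open>(A) linearity\<close>
     (\<forall>dt \<phi> r. dt > 0 \<and> \<phi> \<in> D\<^sub>L \<and> admissible \<Omega> k F \<phi> \<and> (\<forall>i\<in>{1..k}. 0 < r i) \<longrightarrow>
        linear_equation \<Omega> D\<^sub>L D\<^sub>G (\<lambda>\<phi>' \<mu>. phi_residual G dt \<phi> \<phi>' \<mu>) \<and>
        linear_equation \<Omega> D\<^sub>L D\<^sub>G (\<lambda>\<phi>' \<mu>. mu_residual \<Omega> L C k F r \<phi> \<phi>' \<mu>) \<and>
        (\<forall>\<phi>'\<in>D\<^sub>L. \<forall>i\<in>{1..k}. \<forall>r'>0.
           r_residual \<Omega> C (F i) dt (r i) \<phi> \<phi> \<phi>' (r i) r' = 0 \<longleftrightarrow>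
           ln r' = ln (r i) + (1 / C) * l2_inner \<Omega> (sav_b \<Omega> C (F i) (r i) \<phi>) (\<lambda>x. \<phi>' x - \<phi> x))) \<and>
    \<comment> \<open>(A) first-order accuracy\<close>
     (\<forall>T \<phi> \<mu> r. T > 0 \<and> continuous_solution \<Omega> D\<^sub>L L D\<^sub>G G C k F T \<phi> \<mu> r \<and>
        sufficiently_regular \<Omega> L G k 1 T \<phi> \<mu> r \<longrightarrow>
        (\<exists>K. \<forall>N\<ge>1. \<forall>n<N.
           let dt = T / real N; t\<^sub>0 = real n * dt; t\<^sub>1 = (real n + 1) * dt in
           (AE x in lebesgue_on \<Omega>. \<bar>phi_residual G dt (\<phi> t\<^sub>0) (\<phi> t\<^sub>1) (\<mu> t\<^sub>1) x\<bar> \<le> K * dt) \<and>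
           (AE x in lebesgue_on \<Omega>.
              \<bar>mu_residual \<Omega> L C k F (\<lambda>i. r i t\<^sub>0) (\<phi> t\<^sub>0) (\<phi> t\<^sub>1) (\<mu> t\<^sub>1) x\<bar> \<le> K * dt) \<and>
           (\<forall>i\<in>{1..k}. \<bar>r_residual \<Omega> C (F i) dt (r i t\<^sub>0) (\<phi> t\<^sub>0) (\<phi> t\<^sub>0) (\<phi> t\<^sub>1) (r i t\<^sub>0) (r i t\<^sub>1)\<bar>
              \<le> K * dt))) \<and>
    \<comment> \<open>(A) unconditional energy stability\<close>
     (\<forall>dt \<phi> r \<phi>' \<mu> r'. dt > 0 \<and> \<phi> \<in> D\<^sub>L \<and> admissible \<Omega> k F \<phi> \<and> (\<forall>i\<in>{1..k}. 0 < r i) \<and>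
        me_sav_1st \<Omega> D\<^sub>L L D\<^sub>G G C k F dt \<phi> r \<phi>' \<mu> r' \<longrightarrow>
        (1 / dt) * (me_sav_energy \<Omega> L C k \<phi>' r' - me_sav_energy \<Omega> L C k \<phi> r)
          \<le> l2_inner \<Omega> (G \<mu>) \<mu>
             - (1 / (2 * dt)) * l2_inner \<Omega> (\<lambda>x. \<phi>' x - \<phi> x) (L (\<lambda>x. \<phi>' x - \<phi> x)) \<and>
        l2_inner \<Omega> (G \<mu>) \<mu>
             - (1 / (2 * dt)) * l2_inner \<Omega> (\<lambda>x. \<phi>' x - \<phi> x) (L (\<lambda>x. \<phi>' x - \<phi> x)) \<le> 0) \<and>
    \<comment> \<open>(B) linearity\<close>
     (\<forall>dt \<phi> r \<eta> \<rho>. dt > 0 \<and> \<phi> \<in> D\<^sub>L \<and> admissible \<Omega> k F \<eta> \<and> (\<forall>i\<in>{1..k}. 0 < r i) \<longrightarrow>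
        linear_equation \<Omega> D\<^sub>L D\<^sub>G (\<lambda>\<phi>' \<mu>. phi_residual G dt \<phi> \<phi>' \<mu>) \<and>
        linear_equation \<Omega> D\<^sub>L D\<^sub>G (\<lambda>\<phi>' \<mu>. mu_residual \<Omega> L C k F \<rho> \<eta> (midpoint_fun \<phi> \<phi>') \<mu>) \<and>
        (\<forall>\<phi>'\<in>D\<^sub>L. \<forall>i\<in>{1..k}. \<forall>r'>0.
           r_residual \<Omega> C (F i) dt (\<rho> i) \<eta> \<phi> \<phi>' (r i) r' = 0 \<longleftrightarrow>
           ln r' = ln (r i) + (1 / C) * l2_inner \<Omega> (sav_b \<Omega> C (F i) (\<rho> i) \<eta>) (\<lambda>x. \<phi>' x - \<phi> x))) \<and>
    \<comment> \<open>(B) second-order accuracy; in particular for the extrapolated explicit values\<close>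
     (\<forall>T \<phi> \<mu> r. T > 0 \<and> continuous_solution \<Omega> D\<^sub>L L D\<^sub>G G C k F T \<phi> \<mu> r \<and>
        sufficiently_regular \<Omega> L G k 2 T \<phi> \<mu> r \<longrightarrow>
        (\<forall>K\<^sub>0. \<exists>K. \<forall>N\<ge>1. \<forall>n<N. \<forall>\<eta>\<in>l2_space \<Omega>. \<forall>\<rho>.
           let dt = T / real N; t\<^sub>0 = real n * dt; t\<^sub>m = (real n + 1 / 2) * dt; t\<^sub>1 = (real n + 1) * dt in
           (AE x in lebesgue_on \<Omega>. \<bar>\<eta> x - \<phi> t\<^sub>m x\<bar> \<le> K\<^sub>0 * dt\<^sup>2) \<and>
           (\<forall>i\<in>{1..k}. \<bar>\<rho> i - r i t\<^sub>m\<bar> \<le> K\<^sub>0 * dt\<^sup>2) \<longrightarrow>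
           (AE x in lebesgue_on \<Omega>. \<bar>phi_residual G dt (\<phi> t\<^sub>0) (\<phi> t\<^sub>1) (\<mu> t\<^sub>m) x\<bar> \<le> K * dt\<^sup>2) \<and>
           (AE x in lebesgue_on \<Omega>.
              \<bar>mu_residual \<Omega> L C k F \<rho> \<eta> (midpoint_fun (\<phi> t\<^sub>0) (\<phi> t\<^sub>1)) (\<mu> t\<^sub>m) x\<bar> \<le> K * dt\<^sup>2) \<and>
           (\<forall>i\<in>{1..k}. \<bar>r_residual \<Omega> C (F i) dt (\<rho> i) \<eta> (\<phi> t\<^sub>0) (\<phi> t\<^sub>1) (r i t\<^sub>0) (r i t\<^sub>1)\<bar>
              \<le> K * dt\<^sup>2)) \<and>
        (\<exists>K. \<forall>N. \<forall>n\<in>{1..<N}.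
           let dt = T / real N; t\<^sub>p = (real n - 1) * dt; t\<^sub>0 = real n * dt; t\<^sub>m = (real n + 1 / 2) * dt in
           (AE x in lebesgue_on \<Omega>. \<bar>3 / 2 * \<phi> t\<^sub>0 x - 1 / 2 * \<phi> t\<^sub>p x - \<phi> t\<^sub>m x\<bar> \<le> K * dt\<^sup>2) \<and>
           (\<forall>i\<in>{1..k}. \<bar>3 / 2 * r i t\<^sub>0 - 1 / 2 * r i t\<^sub>p - r i t\<^sub>m\<bar> \<le> K * dt\<^sup>2))) \<and>
    \<comment> \<open>(B) unconditional energy stability\<close>
     (\<forall>dt \<phi> r \<eta> \<rho> \<phi>' \<mu> r'. dt > 0 \<and> \<phi> \<in> D\<^sub>L \<and> admissible \<Omega> k F \<eta> \<and> (\<forall>i\<in>{1..k}. 0 < r i) \<and>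
        me_sav_cn \<Omega> D\<^sub>L L D\<^sub>G G C k F dt \<phi> r \<eta> \<rho> \<phi>' \<mu> r' \<longrightarrow>
        (1 / dt) * (me_sav_energy \<Omega> L C k \<phi>' r' - me_sav_energy \<Omega> L C k \<phi> r) \<le> l2_inner \<Omega> (G \<mu>) \<mu> \<and>
        l2_inner \<Omega> (G \<mu>) \<mu> \<le> 0)"
proof (intro conjI)
  note ops = assms(2-5) and C = assms(7)
  show "\<forall>dt \<phi> r. dt > 0 \<and> \<phi> \<in> D\<^sub>L \<and> admissible \<Omega> k F \<phi> \<and> (\<forall>i\<in>{1..k}. 0 < r i) \<longrightarrow>
        linear_equation \<Omega> D\<^sub>L D\<^sub>G (\<lambda>\<phi>' \<mu>. phi_residual G dt \<phi> \<phi>' \<mu>) \<and>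
        linear_equation \<Omega> D\<^sub>L D\<^sub>G (\<lambda>\<phi>' \<mu>. mu_residual \<Omega> L C k F r \<phi> \<phi>' \<mu>) \<and>
        (\<forall>\<phi>'\<in>D\<^sub>L. \<forall>i\<in>{1..k}. \<forall>r'>0.
           r_residual \<Omega> C (F i) dt (r i) \<phi> \<phi> \<phi>' (r i) r' = 0 \<longleftrightarrow>
           ln r' = ln (r i) + (1 / C) * l2_inner \<Omega> (sav_b \<Omega> C (F i) (r i) \<phi>) (\<lambda>x. \<phi>' x - \<phi> x))"
    by (intro allI impI conjI ballI phi_equation_linear[OF ops(3)] mu_equation_linear[OF ops(1)]
        r_residual_eq_0_iff) (elim conjE)
  show "\<forall>dt \<phi> r \<eta> \<rho>. dt > 0 \<and> \<phi> \<in> D\<^sub>L \<and> admissible \<Omega> k F \<eta> \<and> (\<forall>i\<in>{1..k}. 0 < r i) \<longrightarrow>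
        linear_equation \<Omega> D\<^sub>L D\<^sub>G (\<lambda>\<phi>' \<mu>. phi_residual G dt \<phi> \<phi>' \<mu>) \<and>
        linear_equation \<Omega> D\<^sub>L D\<^sub>G (\<lambda>\<phi>' \<mu>. mu_residual \<Omega> L C k F \<rho> \<eta> (midpoint_fun \<phi> \<phi>') \<mu>) \<and>
        (\<forall>\<phi>'\<in>D\<^sub>L. \<forall>i\<in>{1..k}. \<forall>r'>0.
           r_residual \<Omega> C (F i) dt (\<rho> i) \<eta> \<phi> \<phi>' (r i) r' = 0 \<longleftrightarrow>
           ln r' = ln (r i) + (1 / C) * l2_inner \<Omega> (sav_b \<Omega> C (F i) (\<rho> i) \<eta>) (\<lambda>x. \<phi>' x - \<phi> x))"
    by (intro allI impI conjI ballI phi_equation_linear[OF ops(3)]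
        mu_midpoint_equation_linear[OF ops(1)] r_residual_eq_0_iff; elim conjE)
  show "\<forall>dt \<phi> r \<phi>' \<mu> r'. dt > 0 \<and> \<phi> \<in> D\<^sub>L \<and> admissible \<Omega> k F \<phi> \<and> (\<forall>i\<in>{1..k}. 0 < r i) \<and>
        me_sav_1st \<Omega> D\<^sub>L L D\<^sub>G G C k F dt \<phi> r \<phi>' \<mu> r' \<longrightarrow>
        (1 / dt) * (me_sav_energy \<Omega> L C k \<phi>' r' - me_sav_energy \<Omega> L C k \<phi> r)
          \<le> l2_inner \<Omega> (G \<mu>) \<mu>
             - (1 / (2 * dt)) * l2_inner \<Omega> (\<lambda>x. \<phi>' x - \<phi> x) (L (\<lambda>x. \<phi>' x - \<phi> x)) \<and>
        l2_inner \<Omega> (G \<mu>) \<mu>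
             - (1 / (2 * dt)) * l2_inner \<Omega> (\<lambda>x. \<phi>' x - \<phi> x) (L (\<lambda>x. \<phi>' x - \<phi> x)) \<le> 0"
    by (intro allI impI conjI; elim conjE)
      (rule eq_refl[OF me_sav_1st_energy_stable(1)[OF ops C]] me_sav_1st_energy_stable(2)[OF ops C],
        assumption+)+
  show "\<forall>dt \<phi> r \<eta> \<rho> \<phi>' \<mu> r'. dt > 0 \<and> \<phi> \<in> D\<^sub>L \<and> admissible \<Omega> k F \<eta> \<and> (\<forall>i\<in>{1..k}. 0 < r i) \<and>
        me_sav_cn \<Omega> D\<^sub>L L D\<^sub>G G C k F dt \<phi> r \<eta> \<rho> \<phi>' \<mu> r' \<longrightarrow>
        (1 / dt) * (me_sav_energy \<Omega> L C k \<phi>' r' - me_sav_energy \<Omega> L C k \<phi> r) \<le> l2_inner \<Omega> (G \<mu>) \<mu> \<and>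
        l2_inner \<Omega> (G \<mu>) \<mu> \<le> 0"
    by (intro allI impI conjI; elim conjE)
      (rule eq_refl[OF me_sav_cn_energy_stable(1)[OF ops C]] me_sav_cn_energy_stable(2)[OF ops C],
        assumption+)+
next
  show "\<forall>T \<phi> \<mu> r. T > 0 \<and> continuous_solution \<Omega> D\<^sub>L L D\<^sub>G G C k F T \<phi> \<mu> r \<and>
        sufficiently_regular \<Omega> L G k 1 T \<phi> \<mu> r \<longrightarrow>
        (\<exists>K. \<forall>N\<ge>1. \<forall>n<N.
           let dt = T / real N; t\<^sub>0 = real n * dt; t\<^sub>1 = (real n + 1) * dt in
           (AE x in lebesgue_on \<Omega>. \<bar>phi_residual G dt (\<phi> t\<^sub>0) (\<phi> t\<^sub>1) (\<mu> t\<^sub>1) x\<bar> \<le> K * dt) \<and>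
           (AE x in lebesgue_on \<Omega>.
              \<bar>mu_residual \<Omega> L C k F (\<lambda>i. r i t\<^sub>0) (\<phi> t\<^sub>0) (\<phi> t\<^sub>1) (\<mu> t\<^sub>1) x\<bar> \<le> K * dt) \<and>
           (\<forall>i\<in>{1..k}. \<bar>r_residual \<Omega> C (F i) dt (r i t\<^sub>0) (\<phi> t\<^sub>0) (\<phi> t\<^sub>0) (\<phi> t\<^sub>1) (r i t\<^sub>0) (r i t\<^sub>1)\<bar>
              \<le> K * dt))"
  proof (intro allI impI, elim conjE)
    fix T \<phi> \<mu> r
    assume T: "(T::real) > 0" and sol: "continuous_solution \<Omega> D\<^sub>L L D\<^sub>G G C k F T \<phi> \<mu> r"
      and reg: "sufficiently_regular \<Omega> L G k 1 T \<phi> \<mu> r"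
    interpret regular_sav_solution \<Omega> D\<^sub>L D\<^sub>G L G C k F 1 T \<phi> \<mu> r
      by unfold_locales (use assms T sol reg in auto)
    obtain K where K: "\<forall>s h. 0 \<le> s \<longrightarrow> 0 < h \<longrightarrow> s + h \<le> T \<longrightarrow>
      (AE x in lebesgue_on \<Omega>. \<bar>phi_residual G h (\<phi> s) (\<phi> (s + h)) (\<mu> (s + h)) x\<bar> \<le> K * h) \<and>
      (AE x in lebesgue_on \<Omega>.
        \<bar>mu_residual \<Omega> L C k F (\<lambda>i. r i s) (\<phi> s) (\<phi> (s + h)) (\<mu> (s + h)) x\<bar> \<le> K * h) \<and>
      (\<forall>i\<in>{1..k}. \<bar>r_residual \<Omega> C (F i) h (r i s) (\<phi> s) (\<phi> s) (\<phi> (s + h)) (r i s) (r i (s + h))\<bar>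
        \<le> K * h)"
      using first_order_residuals by (elim exE)
    show "\<exists>K. \<forall>N\<ge>1. \<forall>n<N.
           let dt = T / real N; t\<^sub>0 = real n * dt; t\<^sub>1 = (real n + 1) * dt in
           (AE x in lebesgue_on \<Omega>. \<bar>phi_residual G dt (\<phi> t\<^sub>0) (\<phi> t\<^sub>1) (\<mu> t\<^sub>1) x\<bar> \<le> K * dt) \<and>
           (AE x in lebesgue_on \<Omega>.
              \<bar>mu_residual \<Omega> L C k F (\<lambda>i. r i t\<^sub>0) (\<phi> t\<^sub>0) (\<phi> t\<^sub>1) (\<mu> t\<^sub>1) x\<bar> \<le> K * dt) \<and>
           (\<forall>i\<in>{1..k}. \<bar>r_residual \<Omega> C (F i) dt (r i t\<^sub>0) (\<phi> t\<^sub>0) (\<phi> t\<^sub>0) (\<phi> t\<^sub>1) (r i t\<^sub>0) (r i t\<^sub>1)\<bar>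
              \<le> K * dt)"
    proof (intro exI[of _ K] allI impI)
      fix N n :: nat assume "1 \<le> N" "n < N"
      note grid = time_grid[OF T this refl]
      from K[rule_format, OF grid(2) grid(1) grid(3)]
      show "let dt = T / real N; t\<^sub>0 = real n * dt; t\<^sub>1 = (real n + 1) * dt in
           (AE x in lebesgue_on \<Omega>. \<bar>phi_residual G dt (\<phi> t\<^sub>0) (\<phi> t\<^sub>1) (\<mu> t\<^sub>1) x\<bar> \<le> K * dt) \<and>
           (AE x in lebesgue_on \<Omega>.
              \<bar>mu_residual \<Omega> L C k F (\<lambda>i. r i t\<^sub>0) (\<phi> t\<^sub>0) (\<phi> t\<^sub>1) (\<mu> t\<^sub>1) x\<bar> \<le> K * dt) \<and>
           (\<forall>i\<in>{1..k}. \<bar>r_residual \<Omega> C (F i) dt (r i t\<^sub>0) (\<phi> t\<^sub>0) (\<phi> t\<^sub>0) (\<phi> t\<^sub>1) (r i t\<^sub>0) (r i t\<^sub>1)\<bar>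
              \<le> K * dt)"
        unfolding Let_def grid(5) by blast
    qed
  qed
next
  show "\<forall>T \<phi> \<mu> r. T > 0 \<and> continuous_solution \<Omega> D\<^sub>L L D\<^sub>G G C k F T \<phi> \<mu> r \<and>
        sufficiently_regular \<Omega> L G k 2 T \<phi> \<mu> r \<longrightarrow>
        (\<forall>K\<^sub>0. \<exists>K. \<forall>N\<ge>1. \<forall>n<N. \<forall>\<eta>\<in>l2_space \<Omega>. \<forall>\<rho>.
           let dt = T / real N; t\<^sub>0 = real n * dt; t\<^sub>m = (real n + 1 / 2) * dt; t\<^sub>1 = (real n + 1) * dt in
           (AE x in lebesgue_on \<Omega>. \<bar>\<eta> x - \<phi> t\<^sub>m x\<bar> \<le> K\<^sub>0 * dt\<^sup>2) \<and>
           (\<forall>i\<in>{1..k}. \<bar>\<rho> i - r i t\<^sub>m\<bar> \<le> K\<^sub>0 * dt\<^sup>2) \<longrightarrow>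
           (AE x in lebesgue_on \<Omega>. \<bar>phi_residual G dt (\<phi> t\<^sub>0) (\<phi> t\<^sub>1) (\<mu> t\<^sub>m) x\<bar> \<le> K * dt\<^sup>2) \<and>
           (AE x in lebesgue_on \<Omega>.
              \<bar>mu_residual \<Omega> L C k F \<rho> \<eta> (midpoint_fun (\<phi> t\<^sub>0) (\<phi> t\<^sub>1)) (\<mu> t\<^sub>m) x\<bar> \<le> K * dt\<^sup>2) \<and>
           (\<forall>i\<in>{1..k}. \<bar>r_residual \<Omega> C (F i) dt (\<rho> i) \<eta> (\<phi> t\<^sub>0) (\<phi> t\<^sub>1) (r i t\<^sub>0) (r i t\<^sub>1)\<bar>
              \<le> K * dt\<^sup>2)) \<and>
        (\<exists>K. \<forall>N. \<forall>n\<in>{1..<N}.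
           let dt = T / real N; t\<^sub>p = (real n - 1) * dt; t\<^sub>0 = real n * dt; t\<^sub>m = (real n + 1 / 2) * dt in
           (AE x in lebesgue_on \<Omega>. \<bar>3 / 2 * \<phi> t\<^sub>0 x - 1 / 2 * \<phi> t\<^sub>p x - \<phi> t\<^sub>m x\<bar> \<le> K * dt\<^sup>2) \<and>
           (\<forall>i\<in>{1..k}. \<bar>3 / 2 * r i t\<^sub>0 - 1 / 2 * r i t\<^sub>p - r i t\<^sub>m\<bar> \<le> K * dt\<^sup>2))"
  proof (intro allI impI, elim conjE, intro conjI allI)
    fix T \<phi> \<mu> r and K\<^sub>0 :: real
    assume T: "(T::real) > 0" and sol: "continuous_solution \<Omega> D\<^sub>L L D\<^sub>G G C k F T \<phi> \<mu> r"
      and reg: "sufficiently_regular \<Omega> L G k 2 T \<phi> \<mu> r"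
    interpret regular_sav_solution \<Omega> D\<^sub>L D\<^sub>G L G C k F 2 T \<phi> \<mu> r
      by unfold_locales (use assms T sol reg in auto)
    obtain K where K: "\<forall>s h. 0 \<le> s \<longrightarrow> 0 < h \<longrightarrow> s + h \<le> T \<longrightarrow> (\<forall>\<eta>\<in>l2_space \<Omega>. \<forall>\<rho>.
      (AE x in lebesgue_on \<Omega>. \<bar>\<eta> x - \<phi> (s + h / 2) x\<bar> \<le> K\<^sub>0 * h\<^sup>2) \<longrightarrow>
      (\<forall>i\<in>{1..k}. \<bar>\<rho> i - r i (s + h / 2)\<bar> \<le> K\<^sub>0 * h\<^sup>2) \<longrightarrow>
      (AE x in lebesgue_on \<Omega>. \<bar>phi_residual G h (\<phi> s) (\<phi> (s + h)) (\<mu> (s + h / 2)) x\<bar> \<le> K * h\<^sup>2) \<and>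
      (AE x in lebesgue_on \<Omega>.
        \<bar>mu_residual \<Omega> L C k F \<rho> \<eta> (midpoint_fun (\<phi> s) (\<phi> (s + h))) (\<mu> (s + h / 2)) x\<bar> \<le> K * h\<^sup>2) \<and>
      (\<forall>i\<in>{1..k}. \<bar>r_residual \<Omega> C (F i) h (\<rho> i) \<eta> (\<phi> s) (\<phi> (s + h)) (r i s) (r i (s + h))\<bar>
        \<le> K * h\<^sup>2))"
      using second_order_residuals[OF refl, of K\<^sub>0] by (elim exE)
    show "\<exists>K. \<forall>N\<ge>1. \<forall>n<N. \<forall>\<eta>\<in>l2_space \<Omega>. \<forall>\<rho>.
           let dt = T / real N; t\<^sub>0 = real n * dt; t\<^sub>m = (real n + 1 / 2) * dt; t\<^sub>1 = (real n + 1) * dt in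
           (AE x in lebesgue_on \<Omega>. \<bar>\<eta> x - \<phi> t\<^sub>m x\<bar> \<le> K\<^sub>0 * dt\<^sup>2) \<and>
           (\<forall>i\<in>{1..k}. \<bar>\<rho> i - r i t\<^sub>m\<bar> \<le> K\<^sub>0 * dt\<^sup>2) \<longrightarrow>
           (AE x in lebesgue_on \<Omega>. \<bar>phi_residual G dt (\<phi> t\<^sub>0) (\<phi> t\<^sub>1) (\<mu> t\<^sub>m) x\<bar> \<le> K * dt\<^sup>2) \<and>
           (AE x in lebesgue_on \<Omega>.
              \<bar>mu_residual \<Omega> L C k F \<rho> \<eta> (midpoint_fun (\<phi> t\<^sub>0) (\<phi> t\<^sub>1)) (\<mu> t\<^sub>m) x\<bar> \<le> K * dt\<^sup>2) \<and>
           (\<forall>i\<in>{1..k}. \<bar>r_residual \<Omega> C (F i) dt (\<rho> i) \<eta> (\<phi> t\<^sub>0) (\<phi> t\<^sub>1) (r i t\<^sub>0) (r i t\<^sub>1)\<bar>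
              \<le> K * dt\<^sup>2)"
      unfolding Let_def
    proof (intro exI[of _ K] allI ballI impI; elim conjE)
      fix N n :: nat and \<eta> \<rho> assume N: "1 \<le> N" "n < N" and \<eta>: "\<eta> \<in> l2_space \<Omega>"
      note grid = time_grid[OF T N refl]
      assume "AE x in lebesgue_on \<Omega>. \<bar>\<eta> x - \<phi> ((real n + 1 / 2) * (T / real N)) x\<bar> \<le> K\<^sub>0 * (T / real N)\<^sup>2"
        and "\<forall>i\<in>{1..k}. \<bar>\<rho> i - r i ((real n + 1 / 2) * (T / real N))\<bar> \<le> K\<^sub>0 * (T / real N)\<^sup>2"
      from K[THEN spec, THEN spec, THEN mp[OF _ grid(2)], THEN mp[OF _ grid(1)], THEN mp[OF _ grid(3)],
          THEN bspec[OF _ \<eta>], THEN spec, THEN mp[OF _ this(1)[unfolded grid(6)]],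
          THEN mp[OF _ this(2)[unfolded grid(6)]]]
      show "(AE x in lebesgue_on \<Omega>. \<bar>phi_residual G (T / real N) (\<phi> (real n * (T / real N)))
              (\<phi> ((real n + 1) * (T / real N))) (\<mu> ((real n + 1 / 2) * (T / real N))) x\<bar> \<le> K * (T / real N)\<^sup>2) \<and>
           (AE x in lebesgue_on \<Omega>.
              \<bar>mu_residual \<Omega> L C k F \<rho> \<eta> (midpoint_fun (\<phi> (real n * (T / real N)))
                (\<phi> ((real n + 1) * (T / real N)))) (\<mu> ((real n + 1 / 2) * (T / real N))) x\<bar> \<le> K * (T / real N)\<^sup>2) \<and>
           (\<forall>i\<in>{1..k}. \<bar>r_residual \<Omega> C (F i) (T / real N) (\<rho> i) \<eta> (\<phi> (real n * (T / real N)))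
                (\<phi> ((real n + 1) * (T / real N))) (r i (real n * (T / real N))) (r i ((real n + 1) * (T / real N)))\<bar>
              \<le> K * (T / real N)\<^sup>2)"
        unfolding grid(5) grid(6) .
    qed
  next
    fix T \<phi> \<mu> r
    assume T: "(T::real) > 0" and sol: "continuous_solution \<Omega> D\<^sub>L L D\<^sub>G G C k F T \<phi> \<mu> r"
      and reg: "sufficiently_regular \<Omega> L G k 2 T \<phi> \<mu> r"
    interpret regular_sav_solution \<Omega> D\<^sub>L D\<^sub>G L G C k F 2 T \<phi> \<mu> r
      by unfold_locales (use assms T sol reg in auto)
    obtain K where K: "\<forall>s h. 0 < h \<longrightarrow> h \<le> s \<longrightarrow> s + h / 2 \<le> T \<longrightarrow>
      (AE x in lebesgue_on \<Omega>. \<bar>3 / 2 * \<phi> s x - 1 / 2 * \<phi> (s - h) x - \<phi> (s + h / 2) x\<bar> \<le> K * h\<^sup>2) \<and>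
      (\<forall>i\<in>{1..k}. \<bar>3 / 2 * r i s - 1 / 2 * r i (s - h) - r i (s + h / 2)\<bar> \<le> K * h\<^sup>2)"
      using extrapolation_second_order by (elim exE)
    show "\<exists>K. \<forall>N. \<forall>n\<in>{1..<N}.
           let dt = T / real N; t\<^sub>p = (real n - 1) * dt; t\<^sub>0 = real n * dt; t\<^sub>m = (real n + 1 / 2) * dt in
           (AE x in lebesgue_on \<Omega>. \<bar>3 / 2 * \<phi> t\<^sub>0 x - 1 / 2 * \<phi> t\<^sub>p x - \<phi> t\<^sub>m x\<bar> \<le> K * dt\<^sup>2) \<and>
           (\<forall>i\<in>{1..k}. \<bar>3 / 2 * r i t\<^sub>0 - 1 / 2 * r i t\<^sub>p - r i t\<^sub>m\<bar> \<le> K * dt\<^sup>2)"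
    proof (intro exI[of _ K] allI ballI)
      fix N n :: nat assume n: "n \<in> {1..<N}"
      then have N: "1 \<le> N" "n < N" by auto
      note grid = time_grid[OF T N refl]
      have "1 * (T / real N) \<le> real n * (T / real N)"
        using n grid(1) by (intro mult_right_mono) auto
      then have prev: "T / real N \<le> real n * (T / real N)"
        by (simp only: mult_1_left)
      from K[rule_format, OF grid(1) prev grid(4)]
      show "let dt = T / real N; t\<^sub>p = (real n - 1) * dt; t\<^sub>0 = real n * dt; t\<^sub>m = (real n + 1 / 2) * dt in
           (AE x in lebesgue_on \<Omega>. \<bar>3 / 2 * \<phi> t\<^sub>0 x - 1 / 2 * \<phi> t\<^sub>p x - \<phi> t\<^sub>m x\<bar> \<le> K * dt\<^sup>2) \<and>
           (\<forall>i\<in>{1..k}. \<bar>3 / 2 * r i t\<^sub>0 - 1 / 2 * r i t\<^sub>p - r i t\<^sub>m\<bar> \<le> K * dt\<^sup>2)"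
        unfolding Let_def grid(6) grid(7) by blast
    qed
  qed
qed

end
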